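(* Consider stable matching instances with men $m_1,\dots,m_M$ and women $w_1,\dots,w_W$ in which all preference lists are complete: everyone finds every member of the opposite sex acceptable. Each woman independently draws her preference list from a regular distribution. Each man independently draws a uniformly random ordering of all women, independently of the women. For $k\ge1$ let \[u_k=\max_{w,i}\frac{\Pr[m_{i+k}\succ_w m_i]}{\Pr[m_i\succ_w m_{i+k}]},\] the maximum being over women $w$ and indices $i$ with $1\le i<i+k\le M$. Assume $u_k=\exp(-\Omega(k))$: there are constants $A,c>0$, the same for all instances considered, with $u_k\le Ae^{-ck}$ for all $k$. Then, as $N=\min(M,W)\to\infty$, the expected fraction of persons (among all $M+W$ men and women) who have more than one stable partner converges to $0$.
   Context: Matchings and stability: a matching pairs men with women one-to-one, and unmatched persons are single. A pair $(m,w)$ blocks a matching $\mu$ if each prefers the other to his/her partner in $\mu$. A matching is stable if no pair blocks it (with complete lists, no one prefers being single). A stable partner of a person $p$ is someone matched to $p$ in some stable matching. A distribution of preference lists is regular if for every sequence of distinct acceptable partners $a_1,\dots,a_k$ one has $\Pr[a_1\succ a_2\mid a_2\succ\dots\succ a_k]\le\Pr[a_1\succ a_2]$. *)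

theory Defs
  imports "HOL-Probability.Probability" "HOL-Combinatorics.Combinatorics"
begin

text \<open>
  Men are the numbers \<open>1, \<dots>, M\<close> and women are the numbers \<open>1, \<dots>, W\<close>. A complete strict
  preference list over a finite set \<open>S\<close> is an element of \<^term>\<open>permutations_of_set S\<close>,
  written from most to least preferred.
\<close>

definition prefers :: "'a list \<Rightarrow> 'a \<Rightarrow> 'a \<Rightarrow> bool" where
  "prefers l a b \<longleftrightarrow> (\<exists>i j. i < j \<and> j < length l \<and> l ! i = a \<and> l ! j = b)"

definition matching :: "nat \<Rightarrow> nat \<Rightarrow> (nat \<times> nat) set \<Rightarrow> bool" where
  "matching M W \<mu> \<longleftrightarrow>
     \<mu> \<subseteq> {1..M} \<times> {1..W} \<and>
     (\<forall>m w w'. (m, w) \<in> \<mu> \<longrightarrow> (m, w') \<in> \<mu> \<longrightarrow> w = w') \<and>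
     (\<forall>m m' w. (m, w) \<in> \<mu> \<longrightarrow> (m', w) \<in> \<mu> \<longrightarrow> m = m')"

text \<open>
  \<open>P m\<close> is the list of man \<open>m\<close> (over women) and \<open>Q w\<close> the list of woman \<open>w\<close> (over men).
  Lists are complete, so a single person prefers everyone to being single; accordingly the
  conditions below are vacuous for a person without a partner in \<open>\<mu>\<close>.
\<close>

definition blocks ::
  "(nat \<Rightarrow> nat list) \<Rightarrow> (nat \<Rightarrow> nat list) \<Rightarrow> (nat \<times> nat) set \<Rightarrow> nat \<Rightarrow> nat \<Rightarrow> bool" where
  "blocks P Q \<mu> m w \<longleftrightarrow>
     (\<forall>w'. (m, w') \<in> \<mu> \<longrightarrow> prefers (P m) w w') \<and>
     (\<forall>m'. (m', w) \<in> \<mu> \<longrightarrow> prefers (Q w) m m')"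

definition stable_matching ::
  "nat \<Rightarrow> nat \<Rightarrow> (nat \<Rightarrow> nat list) \<Rightarrow> (nat \<Rightarrow> nat list) \<Rightarrow> (nat \<times> nat) set \<Rightarrow> bool" where
  "stable_matching M W P Q \<mu> \<longleftrightarrow>
     matching M W \<mu> \<and> (\<forall>m\<in>{1..M}. \<forall>w\<in>{1..W}. \<not> blocks P Q \<mu> m w)"

definition stable_wives ::
  "nat \<Rightarrow> nat \<Rightarrow> (nat \<Rightarrow> nat list) \<Rightarrow> (nat \<Rightarrow> nat list) \<Rightarrow> nat \<Rightarrow> nat set" where
  "stable_wives M W P Q m = {w. \<exists>\<mu>. stable_matching M W P Q \<mu> \<and> (m, w) \<in> \<mu>}"

definition stable_husbands ::
  "nat \<Rightarrow> nat \<Rightarrow> (nat \<Rightarrow> nat list) \<Rightarrow> (nat \<Rightarrow> nat list) \<Rightarrow> nat \<Rightarrow> nat set" where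
  "stable_husbands M W P Q w = {m. \<exists>\<mu>. stable_matching M W P Q \<mu> \<and> (m, w) \<in> \<mu>}"

definition fraction_multiple ::
  "nat \<Rightarrow> nat \<Rightarrow> (nat \<Rightarrow> nat list) \<Rightarrow> (nat \<Rightarrow> nat list) \<Rightarrow> real" where
  "fraction_multiple M W P Q =
     real (card {m \<in> {1..M}. card (stable_wives M W P Q m) > 1} +
           card {w \<in> {1..W}. card (stable_husbands M W P Q w) > 1}) / real (M + W)"

text \<open>
  Since \<^const>\<open>cond_prob\<close> is \<open>0\<close> when the conditioning event has probability \<open>0\<close>, such
  sequences impose no constraint.
\<close>

definition regular :: "'a set \<Rightarrow> 'a list pmf \<Rightarrow> bool" where
  "regular S p \<longleftrightarrow>
     (\<forall>a b as. distinct (a # b # as) \<longrightarrow> set (a # b # as) \<subseteq> S \<longrightarrow>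
        \<P>(l in measure_pmf p. prefers l a b \<bar> successively (prefers l) (b # as))
          \<le> \<P>(l in measure_pmf p. prefers l a b))"

text \<open>
  The ratio is taken in \<^typ>\<open>ennreal\<close>, so that it is infinite (rather than \<open>0\<close>) when the
  denominator vanishes. For \<open>k \<ge> M\<close> there are no indices and the value is \<open>0\<close>.
\<close>

definition max_pref_ratio :: "nat \<Rightarrow> nat \<Rightarrow> (nat \<Rightarrow> nat list pmf) \<Rightarrow> nat \<Rightarrow> ennreal" where
  "max_pref_ratio M W D k =
     (SUP (w, i) \<in> {1..W} \<times> {i. 1 \<le> i \<and> i + k \<le> M}.
        emeasure (measure_pmf (D w)) {l. prefers l (i + k) i} /
        emeasure (measure_pmf (D w)) {l. prefers l i (i + k)})"

definition random_instance ::
  "nat \<Rightarrow> nat \<Rightarrow> (nat \<Rightarrow> nat list pmf) \<Rightarrow> ((nat \<Rightarrow> nat list) \<times> (nat \<Rightarrow> nat list)) pmf" where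
  "random_instance M W D =
     pair_pmf (Pi_pmf {1..M} [] (\<lambda>_. pmf_of_set (permutations_of_set {1..W})))
              (Pi_pmf {1..W} [] D)"

definition expected_fraction :: "nat \<Rightarrow> nat \<Rightarrow> (nat \<Rightarrow> nat list pmf) \<Rightarrow> real" where
  "expected_fraction M W D =
     measure_pmf.expectation (random_instance M W D) (\<lambda>(P, Q). fraction_multiple M W P Q)"

end

theory Submission
  imports Defs "HOL-Real_Asymp.Real_Asymp"
begin

text \<open>
  With high probability every woman prefers each man to all those at least \<open>L\<close> places after him,
  where \<open>L\<close> is a small power of \<open>N\<close>. Fix \<open>s\<close> and let \<open>T\<close> be the set of women used by a
  stable matching of the men up to \<open>s\<close> only; it does not depend on the lists of the later men. In any
  stable matching \<open>\<mu>\<close> of the whole instance, all but \<open>L\<close> of the men up to \<open>s\<close> are matched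
  inside \<open>T\<close>. The lists of the next \<open>g\<close> men, with \<open>L\<close> much smaller than \<open>g\<close>, are random and
  very likely compete for different women outside \<open>T\<close>; in that case all but \<open>2 * L\<close> of these men get
  their first choice outside \<open>T\<close> in \<open>\<mu>\<close>. Applied to the man-optimal and to the woman-optimal
  matching, this shows that the two agree on almost every such window of men, and a person has several
  stable partners only if the two matchings differ there.
\<close>

section \<open>Preference lists\<close>

lemma prefers_Nil [simp]: "\<not> prefers [] a b"
  by (simp add: prefers_def)

lemma prefers_Cons: "prefers (x # l) a b \<longleftrightarrow> x = a \<and> b \<in> set l \<or> prefers l a b"
proof
  assume "prefers (x # l) a b"
  then obtain i j where ij: "i < j" "j < length (x # l)" "(x # l) ! i = a" "(x # l) ! j = b"
    by (auto simp: prefers_def)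
  from \<open>i < j\<close> obtain j' where j': "j = Suc j'" by (cases j) auto
  show "x = a \<and> b \<in> set l \<or> prefers l a b"
  proof (cases i)
    case 0
    with ij j' show ?thesis by auto
  next
    case (Suc i')
    with ij j' show ?thesis by (auto simp: prefers_def)
  qed
next
  assume "x = a \<and> b \<in> set l \<or> prefers l a b"
  then show "prefers (x # l) a b"
  proof
    assume "x = a \<and> b \<in> set l"
    then obtain j where "j < length l" "l ! j = b" "x = a" by (auto simp: in_set_conv_nth)
    then show ?thesis unfolding prefers_def
      by (intro exI[of _ 0] exI[of _ "Suc j"]) auto
  next
    assume "prefers l a b"
    then obtain i j where "i < j" "j < length l" "l ! i = a" "l ! j = b" by (auto simp: prefers_def)
    then show ?thesis unfolding prefers_def
      by (intro exI[of _ "Suc i"] exI[of _ "Suc j"]) auto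
  qed
qed

lemma prefers_in_set: "prefers l a b \<Longrightarrow> a \<in> set l \<and> b \<in> set l"
  by (induction l) (auto simp: prefers_Cons)

lemma prefers_total: "a \<in> set l \<Longrightarrow> b \<in> set l \<Longrightarrow> a \<noteq> b \<Longrightarrow> prefers l a b \<or> prefers l b a"
  by (induction l) (auto simp: prefers_Cons)

lemma prefers_irrefl: "distinct l \<Longrightarrow> \<not> prefers l a a"
  by (induction l) (auto simp: prefers_Cons)

lemma prefers_trans: "distinct l \<Longrightarrow> prefers l a b \<Longrightarrow> prefers l b c \<Longrightarrow> prefers l a c"
  by (induction l) (auto simp: prefers_Cons dest: prefers_in_set)

lemma prefers_filter: "prefers (filter R l) a b \<Longrightarrow> prefers l a b"
  by (induction l) (auto simp: prefers_Cons split: if_splits)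

lemma prefers_take:
  "a \<in> set (take k l) \<Longrightarrow> b \<in> set l \<Longrightarrow> b \<notin> set (take k l) \<Longrightarrow> prefers l a b"
  by (induction l arbitrary: k) (auto simp: prefers_Cons take_Cons split: nat.splits)

lemma ex_most_preferred:
  assumes "A \<subseteq> set l" "A \<noteq> {}"
  obtains a where "a \<in> A" "\<And>b. b \<in> A \<Longrightarrow> b \<noteq> a \<Longrightarrow> prefers l a b"
proof -
  have "\<exists>a\<in>A. \<forall>b\<in>A. b \<noteq> a \<longrightarrow> prefers l a b"
    using assms
  proof (induction l)
    case (Cons x l)
    show ?case
    proof (cases "x \<in> A")
      case True
      with Cons.prems show ?thesis by (auto intro!: bexI[of _ x] simp: prefers_Cons)
    next
      case False
      with Cons.prems have "A \<subseteq> set l" by auto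
      with Cons.IH Cons.prems show ?thesis by (auto simp: prefers_Cons)
    qed
  qed simp
  with that show ?thesis by blast
qed

section \<open>Matchings, stability and the two optimal stable matchings\<close>

text \<open>Inclusion instead of equality lets the same lists serve the instance cut down to the
  first \<open>s\<close> men, where the women's lists still mention later men.\<close>

definition complete_lists :: "nat \<Rightarrow> nat \<Rightarrow> (nat \<Rightarrow> nat list) \<Rightarrow> bool" where
  "complete_lists m n R \<longleftrightarrow> (\<forall>i\<in>{1..m}. distinct (R i) \<and> {1..n} \<subseteq> set (R i))"

lemma complete_listsD:
  assumes "complete_lists m n R" "i \<in> {1..m}"
  shows "distinct (R i)" "{1..n} \<subseteq> set (R i)"
  using assms by (auto simp: complete_lists_def)

lemma complete_lists_mono:
  "complete_lists m n R \<Longrightarrow> m' \<le> m \<Longrightarrow> n' \<le> n \<Longrightarrow> complete_lists m' n' R"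
  by (fastforce simp: complete_lists_def)

lemma matching_converse: "matching M W \<mu> \<longleftrightarrow> matching W M (\<mu>\<inverse>)"
  by (auto simp: matching_def)

lemma stable_matching_converse: "stable_matching M W P Q \<mu> \<longleftrightarrow> stable_matching W M Q P (\<mu>\<inverse>)"
  unfolding stable_matching_def matching_converse[of M W \<mu>] blocks_def by auto

lemma matchingD:
  assumes "matching M W \<mu>"
  shows "(m, w) \<in> \<mu> \<Longrightarrow> m \<in> {1..M}" "(m, w) \<in> \<mu> \<Longrightarrow> w \<in> {1..W}"
    "(m, w) \<in> \<mu> \<Longrightarrow> (m, w') \<in> \<mu> \<Longrightarrow> w = w'"
    "(m, w) \<in> \<mu> \<Longrightarrow> (m', w) \<in> \<mu> \<Longrightarrow> m = m'"
  using assms unfolding matching_def by blast+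

lemma stable_matchingD:
  assumes "stable_matching M W P Q \<mu>"
  shows "matching M W \<mu>"
    "m \<in> {1..M} \<Longrightarrow> w \<in> {1..W} \<Longrightarrow> \<not> blocks P Q \<mu> m w"
  using assms by (auto simp: stable_matching_def)

lemma finite_matching: "matching M W \<mu> \<Longrightarrow> finite \<mu>"
  by (rule finite_subset[of _ "{1..M} \<times> {1..W}"]) (auto simp: matching_def)

lemma matching_inj_on:
  assumes "matching M W \<mu>"
  shows "inj_on fst \<mu>" "inj_on snd \<mu>"
  using matchingD(3,4)[OF assms] by (auto simp: inj_on_def)

lemma card_matching_le:
  assumes "matching M W \<mu>"
  shows "card \<mu> \<le> M" "card \<mu> \<le> W"
proof -
  have "fst ` \<mu> \<subseteq> {1..M}" "snd ` \<mu> \<subseteq> {1..W}"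
    using matchingD(1,2)[OF assms] by auto
  then have "card (fst ` \<mu>) \<le> M" "card (snd ` \<mu>) \<le> W"
    using card_mono[of "{1..M}"] card_mono[of "{1..W}"] by fastforce+
  then show "card \<mu> \<le> M" "card \<mu> \<le> W"
    by (simp_all add: card_image matching_inj_on[OF assms])
qed

text \<open>
  The fixed-point proof of Gale and Shapley's theorem: \<open>A\<close> collects the pairs that no woman
  rejects, \<open>B\<close> the pairs that no man rejects, and the greatest such \<open>A\<close> is best for the men.
\<close>

lemma ex_man_optimal:
  assumes P: "complete_lists M W P" and Q: "complete_lists W M Q"
  obtains \<mu> where "stable_matching M W P Q \<mu>"
    "\<And>\<nu> m w. stable_matching M W P Q \<nu> \<Longrightarrow> (m, w) \<in> \<nu> \<Longrightarrow>
       \<exists>v. (m, v) \<in> \<mu> \<and> (v = w \<or> prefers (P m) v w)"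
proof -
  define E where "E = {1..M} \<times> {1..W}"
  define U where "U = (\<lambda>B. {(m, w) \<in> E. \<not> (\<exists>m'. (m', w) \<in> B \<and> prefers (Q w) m' m)})"
  define V where "V = (\<lambda>A. {(m, w) \<in> E. \<not> (\<exists>w'. (m, w') \<in> A \<and> prefers (P m) w' w)})"
  \<comment> \<open>\<open>U\<close> and \<open>V\<close> are both antitone, so their composition
    has a greatest fixed point.\<close>
  have "mono (\<lambda>A. U (V A))"
    by (rule monoI) (auto simp: U_def V_def)
  define A where "A = gfp (\<lambda>A. U (V A))"
  define B where "B = V A"
  have AU: "A = U B"
    unfolding B_def A_def by (rule gfp_unfold[OF \<open>mono (\<lambda>A. U (V A))\<close>])
  have AE: "A \<subseteq> E"
    unfolding AU by (auto simp: U_def)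
  have BE: "B \<subseteq> E"
    unfolding B_def by (auto simp: V_def)
  note dP = complete_listsD[OF P] and dQ = complete_listsD[OF Q]
  \<comment> \<open>The favourite of \<open>m\<close> among his pairs in \<open>A\<close> is beaten
    by no pair of \<open>A\<close>, so it lies in \<open>B = V A\<close> too. In the same way
    \<open>bestB\<close> uses \<open>A = U B\<close>.\<close>
  have bestA: "\<exists>v. (m, v) \<in> A \<inter> B \<and> (v = w \<or> prefers (P m) v w)" if "(m, w) \<in> A" for m w
  proof -
    have m: "m \<in> {1..M}" using that AE by (auto simp: E_def)
    have "{v. (m, v) \<in> A} \<subseteq> set (P m)" using dP(2)[OF m] AE by (auto simp: E_def)
    then obtain v where v: "(m, v) \<in> A" "\<And>b. (m, b) \<in> A \<Longrightarrow> b \<noteq> v \<Longrightarrow> prefers (P m) v b"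
      using \<open>(m, w) \<in> A\<close> by (elim ex_most_preferred[of "{v. (m, v) \<in> A}" "P m"]) auto
    have "(m, v) \<in> B"
      unfolding B_def V_def
      using v AE prefers_irrefl[OF dP(1)[OF m]] prefers_trans[OF dP(1)[OF m]] by blast
    with v that show ?thesis by blast
  qed
  have bestB: "\<exists>m'. (m', w) \<in> A \<inter> B \<and> (m' = m \<or> prefers (Q w) m' m)" if "(m, w) \<in> B" for m w
  proof -
    have w: "w \<in> {1..W}" using that BE by (auto simp: E_def)
    have "{v. (v, w) \<in> B} \<subseteq> set (Q w)" using dQ(2)[OF w] BE by (auto simp: E_def)
    then obtain v where v: "(v, w) \<in> B" "\<And>b. (b, w) \<in> B \<Longrightarrow> b \<noteq> v \<Longrightarrow> prefers (Q w) v b"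
      using \<open>(m, w) \<in> B\<close> by (elim ex_most_preferred[of "{v. (v, w) \<in> B}" "Q w"]) auto
    have "(v, w) \<in> A"
      unfolding AU U_def
      using v BE prefers_irrefl[OF dQ(1)[OF w]] prefers_trans[OF dQ(1)[OF w]] by blast
    with v that show ?thesis by blast
  qed
  have mat: "matching M W (A \<inter> B)"
    unfolding matching_def
  proof (intro conjI allI impI)
    show "A \<inter> B \<subseteq> {1..M} \<times> {1..W}" using AE by (auto simp: E_def)
  next
    fix m w w' assume *: "(m, w) \<in> A \<inter> B" "(m, w') \<in> A \<inter> B"
    then have "m \<in> {1..M}" "w \<in> {1..W}" "w' \<in> {1..W}" using AE by (auto simp: E_def)
    then have "w = w' \<or> prefers (P m) w w' \<or> prefers (P m) w' w"
      using prefers_total[of w "P m" w'] dP(2)[of m] by blast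
    with * show "w = w'" unfolding B_def V_def by blast
  next
    fix m m' w assume *: "(m, w) \<in> A \<inter> B" "(m', w) \<in> A \<inter> B"
    then have "w \<in> {1..W}" "m \<in> {1..M}" "m' \<in> {1..M}" using AE by (auto simp: E_def)
    then have "m = m' \<or> prefers (Q w) m m' \<or> prefers (Q w) m' m"
      using prefers_total[of m "Q w" m'] dQ(2)[of w] by blast
    with * show "m = m'" unfolding AU U_def by blast
  qed
  have stable: "stable_matching M W P Q (A \<inter> B)"
    unfolding stable_matching_def
  proof (intro conjI ballI mat)
    fix m w assume m: "m \<in> {1..M}" and w: "w \<in> {1..W}"
    show "\<not> blocks P Q (A \<inter> B) m w"
    proof
      assume bl: "blocks P Q (A \<inter> B) m w"
      have "\<not> prefers (P m) w w" using prefers_irrefl[OF dP(1)[OF m]] .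
      with bl have "(m, w) \<notin> A \<inter> B" unfolding blocks_def by blast
      then consider "(m, w) \<notin> A" | "(m, w) \<notin> B" by blast
      then show False
      proof cases
        case 1
        then obtain m' where m': "(m', w) \<in> B" "prefers (Q w) m' m"
          using m w unfolding AU U_def E_def by blast
        with bestB obtain m'' where m'': "(m'', w) \<in> A \<inter> B" "m'' = m' \<or> prefers (Q w) m'' m'"
          by blast
        with m' have "prefers (Q w) m'' m" using prefers_trans[OF dQ(1)[OF w]] by blast
        moreover from bl m'' have "prefers (Q w) m m''" unfolding blocks_def by blast
        ultimately show False
          using prefers_irrefl[OF dQ(1)[OF w]] prefers_trans[OF dQ(1)[OF w]] by blast
      next
        case 2
        then obtain w' where w': "(m, w') \<in> A" "prefers (P m) w' w"
          using m w unfolding B_def V_def E_def by blast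
        with bestA obtain w'' where w'': "(m, w'') \<in> A \<inter> B" "w'' = w' \<or> prefers (P m) w'' w'"
          by blast
        with w' have "prefers (P m) w'' w" using prefers_trans[OF dP(1)[OF m]] by blast
        moreover from bl w'' have "prefers (P m) w w''" unfolding blocks_def by blast
        ultimately show False
          using prefers_irrefl[OF dP(1)[OF m]] prefers_trans[OF dP(1)[OF m]] by blast
      qed
    qed
  qed
  have opt: "\<exists>v. (m, v) \<in> A \<inter> B \<and> (v = w \<or> prefers (P m) v w)"
    if \<nu>: "stable_matching M W P Q \<nu>" and mw: "(m, w) \<in> \<nu>" for \<nu> m w
  proof -
    note mat\<nu> = matchingD[OF stable_matchingD(1)[OF \<nu>]]
    have sub: "\<nu> \<subseteq> U \<nu>"
    proof clarify
      fix a b assume ab: "(a, b) \<in> \<nu>"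
      then have "a \<in> {1..M}" "b \<in> {1..W}" using mat\<nu> by blast+
      then show "(a, b) \<in> U \<nu>"
        using ab mat\<nu>(4) prefers_irrefl[OF dQ(1)] unfolding U_def E_def by blast
    qed
    \<comment> \<open>Suppose \<open>a'\<close> survives in \<open>V (U \<nu>)\<close> and
      \<open>b\<close> prefers him to \<open>a\<close>. As \<open>(a', b)\<close> does not block
      \<open>\<nu>\<close>, either \<open>a'\<close> is married to \<open>b\<close> in
      \<open>\<nu>\<close> or her husband in \<open>\<nu>\<close> is at least as good as
      \<open>a'\<close>. Either way \<open>b\<close> has a husband better than \<open>a\<close>,
      against \<open>(a, b) \<in> U \<nu>\<close>. So \<open>U \<nu>\<close> is a post-fixed point
      and lies below \<open>A\<close>.\<close>
    have "U \<nu> \<subseteq> U (V (U \<nu>))"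
    proof (clarify, rule ccontr)
      fix a b assume ab: "(a, b) \<in> U \<nu>" "(a, b) \<notin> U (V (U \<nu>))"
      then have b: "b \<in> {1..W}" unfolding U_def E_def by blast
      from ab obtain a' where a': "(a', b) \<in> V (U \<nu>)" "prefers (Q b) a' a"
        unfolding U_def by blast
      then have "a' \<in> {1..M}" unfolding V_def E_def by blast
      then have "\<not> blocks P Q \<nu> a' b" using stable_matchingD(2)[OF \<nu> _ b] by blast
      then consider b' where "(a', b') \<in> \<nu>" "\<not> prefers (P a') b b'"
        | a'' where "(a'', b) \<in> \<nu>" "\<not> prefers (Q b) a' a''"
        unfolding blocks_def by blast
      then show False
      proof cases
        case 1
        then have "\<not> prefers (P a') b' b"
          using a'(1) sub unfolding V_def by blast
        moreover have "b' \<in> {1..W}" using 1 mat\<nu> by blast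
        ultimately have "b' = b"
          using prefers_total[of b "P a'" b'] 1 dP(2)[OF \<open>a' \<in> {1..M}\<close>] b by blast
        with 1 a' ab(1) show False unfolding U_def by blast
      next
        case 2
        then have "a'' \<in> {1..M}" using mat\<nu> by blast
        then have "a'' = a' \<or> prefers (Q b) a'' a'"
          using prefers_total[of a'' "Q b" a'] 2 dQ(2)[OF b] \<open>a' \<in> {1..M}\<close> by blast
        with a' have "prefers (Q b) a'' a" using prefers_trans[OF dQ(1)[OF b]] by blast
        with 2 ab(1) show False unfolding U_def by blast
      qed
    qed
    then have "U \<nu> \<subseteq> A" unfolding A_def by (rule gfp_upperbound)
    with sub mw have "(m, w) \<in> A" by blast
    then show ?thesis by (rule bestA)
  qed
  show ?thesis by (rule that[OF stable]) (use opt in blast)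
qed

lemma ex_stable_matching:
  assumes "complete_lists M W P" "complete_lists W M Q"
  shows "\<exists>\<mu>. stable_matching M W P Q \<mu>"
  using ex_man_optimal[OF assms] by metis

text \<open>Exchange the roles of men and women.\<close>

lemma ex_woman_optimal:
  assumes P: "complete_lists M W P" and Q: "complete_lists W M Q"
  obtains \<mu> where "stable_matching M W P Q \<mu>"
    "\<And>\<nu> m w. stable_matching M W P Q \<nu> \<Longrightarrow> (m, w) \<in> \<nu> \<Longrightarrow>
       \<exists>v. (v, w) \<in> \<mu> \<and> (v = m \<or> prefers (Q w) v m)"
proof -
  obtain \<mu> where \<mu>: "stable_matching W M Q P \<mu>"
    "\<And>\<nu> m w. stable_matching W M Q P \<nu> \<Longrightarrow> (m, w) \<in> \<nu> \<Longrightarrow>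
       \<exists>v. (m, v) \<in> \<mu> \<and> (v = w \<or> prefers (Q m) v w)"
    using ex_man_optimal[OF Q P] by blast
  show ?thesis
  proof (rule that[of "\<mu>\<inverse>"])
    show "stable_matching M W P Q (\<mu>\<inverse>)"
      using \<mu>(1) by (subst stable_matching_converse) simp
    fix \<nu> m w assume "stable_matching M W P Q \<nu>" "(m, w) \<in> \<nu>"
    then have "stable_matching W M Q P (\<nu>\<inverse>)" "(w, m) \<in> \<nu>\<inverse>"
      by (auto simp: stable_matching_converse[of M])
    from \<mu>(2)[OF this] show "\<exists>v. (v, w) \<in> \<mu>\<inverse> \<and> (v = m \<or> prefers (Q w) v m)" by auto
  qed
qed

section \<open>Reduction to the overlap of the two optimal matchings\<close>

lemma card_gt_1E:
  assumes "card A > 1"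
  obtains x y where "x \<in> A" "y \<in> A" "x \<noteq> y"
proof -
  have "finite A" "\<not> card A \<le> Suc 0" using assms card.infinite by (force, simp)
  then show ?thesis using that by (auto simp: card_le_Suc0_iff_eq)
qed

text \<open>Take the man-optimal \<open>\<mu>\<close> and the woman-optimal \<open>\<nu>\<close>. If
  \<open>(m, w)\<close> lies in both, each is the best stable partner of the other. A stable
  matching giving either of them somebody else would then be blocked by \<open>(m, w)\<close>,
  unless the other one had an even better stable partner, which is impossible. So persons in a
  common pair have a single stable partner, and on each side at most
  \<open>min M W - card (\<mu> \<inter> \<nu>)\<close> persons remain.\<close>

lemma fraction_multiple_le:
  assumes P: "complete_lists M W P" and Q: "complete_lists W M Q"
  obtains \<mu> \<nu> where "stable_matching M W P Q \<mu>" "stable_matching M W P Q \<nu>"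
    "fraction_multiple M W P Q \<le> 2 * (real (min M W) - real (card (\<mu> \<inter> \<nu>))) / real (M + W)"
proof -
  obtain \<mu> where \<mu>: "stable_matching M W P Q \<mu>"
    "\<And>\<nu> m w. stable_matching M W P Q \<nu> \<Longrightarrow> (m, w) \<in> \<nu> \<Longrightarrow>
       \<exists>v. (m, v) \<in> \<mu> \<and> (v = w \<or> prefers (P m) v w)"
    using ex_man_optimal[OF P Q] by blast
  obtain \<nu> where \<nu>: "stable_matching M W P Q \<nu>"
    "\<And>\<nu>' m w. stable_matching M W P Q \<nu>' \<Longrightarrow> (m, w) \<in> \<nu>' \<Longrightarrow>
       \<exists>v. (v, w) \<in> \<nu> \<and> (v = m \<or> prefers (Q w) v m)"
    using ex_woman_optimal[OF P Q] by blast
  note m\<mu> = stable_matchingD(1)[OF \<mu>(1)] and m\<nu> = stable_matchingD(1)[OF \<nu>(1)]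
  note dP = complete_listsD[OF P] and dQ = complete_listsD[OF Q]
  have eq_m: "w' = w" if a: "(m, w) \<in> \<mu>" "(m, w) \<in> \<nu>" "stable_matching M W P Q \<mu>'" "(m, w') \<in> \<mu>'"
    for m w \<mu>' w'
  proof (rule ccontr)
    assume "w' \<noteq> w"
    have r: "m \<in> {1..M}" "w \<in> {1..W}" using matchingD[OF m\<mu>] a(1) by blast+
    have "prefers (P m) w w'"
      using \<mu>(2)[OF a(3,4)] a(1) matchingD(3)[OF m\<mu>] \<open>w' \<noteq> w\<close> by blast
    moreover have "\<not> blocks P Q \<mu>' m w" using stable_matchingD(2)[OF a(3)] r by blast
    ultimately obtain m' where m': "(m', w) \<in> \<mu>'" "\<not> prefers (Q w) m m'"
      unfolding blocks_def
      using a(3,4) matchingD(3)[OF stable_matchingD(1)[OF a(3)]] by blast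
    have "m' \<noteq> m"
      using m' a(4) \<open>w' \<noteq> w\<close> matchingD(3)[OF stable_matchingD(1)[OF a(3)]] by blast
    with \<nu>(2)[OF a(3) m'(1)] a(2) m'(2) show False
      using matchingD(4)[OF m\<nu>] by blast
  qed
  have eq_w: "m' = m" if a: "(m, w) \<in> \<mu>" "(m, w) \<in> \<nu>" "stable_matching M W P Q \<mu>'" "(m', w) \<in> \<mu>'"
    for m w \<mu>' m'
  proof (rule ccontr)
    assume "m' \<noteq> m"
    have r: "m \<in> {1..M}" "w \<in> {1..W}" using matchingD[OF m\<mu>] a(1) by blast+
    have "prefers (Q w) m m'"
      using \<nu>(2)[OF a(3,4)] a(2) matchingD(4)[OF m\<nu>] \<open>m' \<noteq> m\<close> by blast
    moreover have "\<not> blocks P Q \<mu>' m w" using stable_matchingD(2)[OF a(3)] r by blast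
    ultimately obtain w' where w': "(m, w') \<in> \<mu>'" "\<not> prefers (P m) w w'"
      unfolding blocks_def
      using a(3,4) matchingD(4)[OF stable_matchingD(1)[OF a(3)]] by blast
    have "w' \<noteq> w"
      using w' a(4) \<open>m' \<noteq> m\<close> matchingD(4)[OF stable_matchingD(1)[OF a(3)]] by blast
    with \<mu>(2)[OF a(3) w'(1)] a(1) w'(2) show False
      using matchingD(3)[OF m\<mu>] by blast
  qed
  have fin: "finite \<mu>" "finite \<nu>" using finite_matching m\<mu> m\<nu> by blast+
  define I where "I = \<mu> \<inter> \<nu>"
  have inj: "inj_on fst \<mu>" "inj_on snd \<nu>" "inj_on fst I" "inj_on snd I"
    using matching_inj_on[OF m\<mu>] matching_inj_on[OF m\<nu>] unfolding I_def
    by (auto intro: inj_on_subset)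
  \<comment> \<open>A man with any stable wife is matched in \<open>\<mu>\<close> by optimality, so
    single men need no separate count.\<close>
  have "{m \<in> {1..M}. card (stable_wives M W P Q m) > 1} \<subseteq> fst ` \<mu> - fst ` I"
  proof (clarify, elim card_gt_1E)
    fix m w w' assume "w \<in> stable_wives M W P Q m" "w' \<in> stable_wives M W P Q m" "w \<noteq> w'"
    then obtain \<mu>1 \<mu>2 where s: "stable_matching M W P Q \<mu>1" "(m, w) \<in> \<mu>1"
      "stable_matching M W P Q \<mu>2" "(m, w') \<in> \<mu>2" by (auto simp: stable_wives_def)
    from \<mu>(2)[OF s(1,2)] have "m \<in> fst ` \<mu>" by force
    moreover have "m \<notin> fst ` I"
      using eq_m[OF _ _ s(1,2)] eq_m[OF _ _ s(3,4)] \<open>w \<noteq> w'\<close> unfolding I_def by fastforce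
    ultimately show "m \<in> fst ` \<mu> - fst ` I" by blast
  qed
  then have "card {m \<in> {1..M}. card (stable_wives M W P Q m) > 1} \<le> card (fst ` \<mu> - fst ` I)"
    by (intro card_mono) (use fin in auto)
  also have "\<dots> = card \<mu> - card I"
    using fin inj by (subst card_Diff_subset) (auto simp: I_def card_image)
  finally have 1: "card {m \<in> {1..M}. card (stable_wives M W P Q m) > 1} \<le> min M W - card I"
    using card_matching_le[OF m\<mu>] by linarith
  have "{w \<in> {1..W}. card (stable_husbands M W P Q w) > 1} \<subseteq> snd ` \<nu> - snd ` I"
  proof (clarify, elim card_gt_1E)
    fix w m m' assume "m \<in> stable_husbands M W P Q w" "m' \<in> stable_husbands M W P Q w" "m \<noteq> m'"
    then obtain \<mu>1 \<mu>2 where s: "stable_matching M W P Q \<mu>1" "(m, w) \<in> \<mu>1"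
      "stable_matching M W P Q \<mu>2" "(m', w) \<in> \<mu>2" by (auto simp: stable_husbands_def)
    from \<nu>(2)[OF s(1,2)] have "w \<in> snd ` \<nu>" by force
    moreover have "w \<notin> snd ` I"
      using eq_w[OF _ _ s(1,2)] eq_w[OF _ _ s(3,4)] \<open>m \<noteq> m'\<close> unfolding I_def by fastforce
    ultimately show "w \<in> snd ` \<nu> - snd ` I" by blast
  qed
  then have "card {w \<in> {1..W}. card (stable_husbands M W P Q w) > 1} \<le> card (snd ` \<nu> - snd ` I)"
    by (intro card_mono) (use fin in auto)
  also have "\<dots> = card \<nu> - card I"
    using fin inj by (subst card_Diff_subset) (auto simp: I_def card_image)
  finally have 2: "card {w \<in> {1..W}. card (stable_husbands M W P Q w) > 1} \<le> min M W - card I"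
    using card_matching_le[OF m\<nu>] by linarith
  have "card I \<le> min M W"
    using card_mono[OF fin(1), of I] card_matching_le[OF m\<mu>] unfolding I_def by force
  with 1 2 have "real (card {m \<in> {1..M}. card (stable_wives M W P Q m) > 1} +
      card {w \<in> {1..W}. card (stable_husbands M W P Q w) > 1}) \<le> 2 * (real (min M W) - real (card I))"
    unfolding of_nat_diff[OF \<open>card I \<le> min M W\<close>, symmetric] by linarith
  then have "fraction_multiple M W P Q \<le> 2 * (real (min M W) - real (card I)) / real (M + W)"
    unfolding fraction_multiple_def by (rule divide_right_mono) simp
  with that[OF \<mu>(1) \<nu>(1)] show ?thesis unfolding I_def by blast
qed

section \<open>Stable matchings when the women nearly agree on the men\<close>

definition nearly_sorted :: "nat \<Rightarrow> nat \<Rightarrow> nat \<Rightarrow> (nat \<Rightarrow> nat list) \<Rightarrow> bool" where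
  "nearly_sorted M W L Q \<longleftrightarrow>
     (\<forall>w\<in>{1..W}. \<forall>i\<in>{1..M}. \<forall>j\<in>{1..M}. i + L \<le> j \<longrightarrow> \<not> prefers (Q w) j i)"

lemma not_blocked_by:
  assumes P: "complete_lists M W P" and Q: "complete_lists W M Q"
    and \<mu>: "stable_matching M W P Q \<mu>"
    and m: "m \<in> {1..M}" and w: "w \<in> {1..W}"
    and "(m, w) \<notin> \<mu>" and "\<And>v. (m, v) \<in> \<mu> \<Longrightarrow> prefers (P m) w v"
  obtains m' where "(m', w) \<in> \<mu>" "prefers (Q w) m' m"
proof -
  have "\<not> blocks P Q \<mu> m w" using stable_matchingD(2)[OF \<mu> m w] .
  then obtain m' where m': "(m', w) \<in> \<mu>" "\<not> prefers (Q w) m m'"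
    using assms unfolding blocks_def by blast
  then have "m' \<noteq> m" "m' \<in> {1..M}"
    using assms(6) matchingD[OF stable_matchingD(1)[OF \<mu>]] by blast+
  then have "prefers (Q w) m' m"
    using prefers_total[of m "Q w" m'] complete_listsD(2)[OF Q w] m m' by blast
  with m' that show ?thesis by blast
qed

text \<open>If \<open>m\<close> were single, every one of the \<open>W\<close> women would have to
  hold a man she prefers to \<open>m\<close>. These men are distinct and all in \<open>C\<close>,
  which is too small.\<close>

lemma matched_if_card_lt:
  assumes P: "complete_lists M W P" and Q: "complete_lists W M Q"
    and \<mu>: "stable_matching M W P Q \<mu>"
    and m: "m \<in> {1..M}" and "finite C" "card C < W"
    and C: "\<And>m' w. w \<in> {1..W} \<Longrightarrow> m' \<in> {1..M} \<Longrightarrow> prefers (Q w) m' m \<Longrightarrow> m' \<in> C"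
  shows "\<exists>w. (m, w) \<in> \<mu>"
proof (rule ccontr)
  assume "\<not> (\<exists>w. (m, w) \<in> \<mu>)"
  then have un: "(m, w) \<notin> \<mu>" for w by blast
  note mat = matchingD[OF stable_matchingD(1)[OF \<mu>]]
  have "\<exists>m'. (m', w) \<in> \<mu> \<and> m' \<in> C" if w: "w \<in> {1..W}" for w
  proof -
    obtain m' where "(m', w) \<in> \<mu>" "prefers (Q w) m' m"
      using not_blocked_by[OF P Q \<mu> m w] un by blast
    with C[OF w] mat(1) show ?thesis by blast
  qed
  then obtain f where f: "\<And>w. w \<in> {1..W} \<Longrightarrow> (f w, w) \<in> \<mu> \<and> f w \<in> C" by metis
  have "inj_on f {1..W}" using f mat(3) by (intro inj_onI) metis
  then have "card {1..W} \<le> card C" using f \<open>finite C\<close> by (intro card_inj_on_le[of f]) auto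
  with \<open>card C < W\<close> show False by simp
qed

lemma all_men_matched:
  assumes P: "complete_lists s W P" and Q: "complete_lists W s Q"
    and \<nu>: "stable_matching s W P Q \<nu>" and m: "m \<in> {1..s}" and "s \<le> W"
  shows "\<exists>w. (m, w) \<in> \<nu>"
proof (rule matched_if_card_lt[OF P Q \<nu> m, of "{1..s} - {m}"])
  show "card ({1..s} - {m}) < W" using m \<open>s \<le> W\<close> by auto
  show "m' \<in> {1..s} - {m}" if "w \<in> {1..W}" "m' \<in> {1..s}" "prefers (Q w) m' m" for m' w
    using that prefers_irrefl[OF complete_listsD(1)[OF Q that(1)]] by blast
qed simp

text \<open>
  The men matched outside the women of \<open>\<nu>\<close> belong to the set \<open>X\<close> of men who prefer \<open>\<nu>\<close> to \<open>\<mu>\<close>.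
  Mapping \<open>i \<in> X\<close> to the man whom \<open>\<mu>\<close> gives to \<open>\<nu> i\<close> is an injection of \<open>X\<close> into itself and the
  \<open>L\<close> men after \<open>s\<close>, and it avoids the former men.
\<close>

lemma card_leaked_le:
  assumes P: "complete_lists M W P" and Q: "complete_lists W M Q"
    and near: "nearly_sorted M W L Q"
    and \<mu>: "stable_matching M W P Q \<mu>" and \<nu>: "stable_matching s W P Q \<nu>"
    and "s \<le> W" "s \<le> M"
  shows "card {i \<in> {1..s}. \<exists>w. w \<notin> snd ` \<nu> \<and> (i, w) \<in> \<mu>} \<le> L" (is "card ?K \<le> L")
proof -
  note mat = matchingD[OF stable_matchingD(1)[OF \<mu>]]
    and mat' = matchingD[OF stable_matchingD(1)[OF \<nu>]]
  have P': "complete_lists s W P" and Q': "complete_lists W s Q"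
    using complete_lists_mono P Q \<open>s \<le> M\<close> by blast+
  obtain f where f: "\<And>i. i \<in> {1..s} \<Longrightarrow> (i, f i) \<in> \<nu>"
    using all_men_matched[OF P' Q' \<nu> _ \<open>s \<le> W\<close>] by metis
  define X where "X = {i \<in> {1..s}. (i, f i) \<notin> \<mu> \<and> (\<forall>w. (i, w) \<in> \<mu> \<longrightarrow> prefers (P i) (f i) w)}"
  \<comment> \<open>A woman outside the range of \<open>\<nu>\<close> is single there and would
    accept \<open>i\<close> at once. Since \<open>i\<close> does not block \<open>\<nu>\<close> with
    her, he prefers \<open>f i\<close>.\<close>
  have K: "?K \<subseteq> X"
  proof clarify
    fix i w assume i: "i \<in> {1..s}" and w: "w \<notin> snd ` \<nu>" "(i, w) \<in> \<mu>"
    have r: "i \<in> {1..M}" "w \<in> {1..W}" using mat w by blast+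
    have unw: "(m, w) \<notin> \<nu>" for m using w(1) by (metis image_eqI snd_conv)
    have fi: "f i \<noteq> w" "f i \<in> {1..W}" using unw f[OF i] mat'(2) by blast+
    have "\<not> blocks P Q \<nu> i w" using stable_matchingD(2)[OF \<nu> i r(2)] .
    then have "\<not> prefers (P i) w (f i)"
      using unw f[OF i] mat'(3) unfolding blocks_def by blast
    then have "prefers (P i) (f i) w"
      using prefers_total[of w "P i" "f i"] complete_listsD(2)[OF P r(1)] fi r by blast
    then show "i \<in> X" unfolding X_def using i w mat(3) fi by blast
  qed
  have "\<exists>i'. (i', f i) \<in> \<mu> \<and> prefers (Q (f i)) i' i" if "i \<in> X" for i
  proof -
    have i: "i \<in> {1..s}" "i \<in> {1..M}" using that \<open>s \<le> M\<close> by (auto simp: X_def)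
    have "(i, f i) \<notin> \<mu>" "\<And>w. (i, w) \<in> \<mu> \<Longrightarrow> prefers (P i) (f i) w"
      using that unfolding X_def by blast+
    from not_blocked_by[OF P Q \<mu> i(2) mat'(2)[OF f[OF i(1)]] this] show ?thesis by blast
  qed
  then obtain g where g: "\<And>i. i \<in> X \<Longrightarrow> (g i, f i) \<in> \<mu> \<and> prefers (Q (f i)) (g i) i" by metis
  have "inj_on g X"
  proof (rule inj_onI)
    fix i j assume ij: "i \<in> X" "j \<in> X" "g i = g j"
    then have "f i = f j" using g mat(3) by metis
    with ij show "i = j" using f mat'(4) unfolding X_def by (metis (no_types, lifting) mem_Collect_eq)
  qed
  \<comment> \<open>Near sortedness gives \<open>g i < i + L\<close>. If \<open>g i\<close> is at
    most \<open>s\<close>, then \<open>f i\<close> prefers him to her husband \<open>i\<close> in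
    \<open>\<nu>\<close>, so by stability of \<open>\<nu>\<close> he prefers his own wife there to
    \<open>f i\<close>, which is what \<open>\<mu>\<close> gives him. Hence \<open>g i\<close> is in
    \<open>X\<close>, and he is not in \<open>?K\<close> because \<open>f i\<close> is matched in
    \<open>\<nu>\<close>.\<close>
  moreover have "g ` X \<subseteq> (X - ?K) \<union> {s<..s+L}"
  proof (rule image_subsetI, rule ccontr)
    fix i assume i: "i \<in> X" and no: "g i \<notin> (X - ?K) \<union> {s<..s+L}"
    have is': "i \<in> {1..s}" using i by (auto simp: X_def)
    have gi: "(g i, f i) \<in> \<mu>" "prefers (Q (f i)) (g i) i" using g[OF i] by blast+
    have r: "g i \<in> {1..M}" "f i \<in> {1..W}" "i \<in> {1..M}" using gi mat is' \<open>s \<le> M\<close> by auto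
    have "\<not> i + L \<le> g i" using near r gi(2) unfolding nearly_sorted_def by blast
    with is' no have gs: "g i \<in> {1..s}" using r(1) by auto
    have fT: "f i \<in> snd ` \<nu>" using f[OF is'] by force
    have ne: "g i \<noteq> i" using gi(2) prefers_irrefl[OF complete_listsD(1)[OF Q r(2)]] by metis
    have nb: "\<not> blocks P Q \<nu> (g i) (f i)" using stable_matchingD(2)[OF \<nu> gs r(2)] .
    have "\<not> prefers (P (g i)) (f i) (f (g i))"
      using nb gi(2) f[OF is'] f[OF gs] mat'(3,4) unfolding blocks_def by metis
    moreover have "f (g i) \<noteq> f i" using f[OF is'] f[OF gs] mat'(4) ne by metis
    moreover have "f (g i) \<in> {1..W}" using f[OF gs] mat' by blast
    ultimately have "prefers (P (g i)) (f (g i)) (f i)"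
      using prefers_total[of "f i" "P (g i)" "f (g i)"]
        subsetD[OF complete_listsD(2)[OF P r(1)]] r(2) by metis
    then have "g i \<in> X" unfolding X_def
      using gs gi(1) mat(3) \<open>f (g i) \<noteq> f i\<close> by blast
    moreover have "g i \<notin> ?K" using gi(1) fT mat(3) by blast
    ultimately show False using no by blast
  qed
  ultimately have "card X \<le> card ((X - ?K) \<union> {s<..s+L})"
    by (intro card_inj_on_le) (auto simp: X_def)
  also have "\<dots> \<le> card (X - ?K) + card {s<..s+L}" by (rule card_Un_le)
  also have "card (X - ?K) = card X - card ?K" using K by (intro card_Diff_subset) auto
  finally show ?thesis
    using card_mono[OF _ K] by (simp add: X_def)
qed

abbreviation free_list :: "nat set \<Rightarrow> nat list \<Rightarrow> nat list" where
  "free_list T l \<equiv> filter (\<lambda>w. w \<notin> T) l"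

definition separated :: "nat set \<Rightarrow> nat \<Rightarrow> nat set \<Rightarrow> (nat \<Rightarrow> nat list) \<Rightarrow> bool" where
  "separated J k T P \<longleftrightarrow>
     (\<forall>i\<in>J. \<forall>j\<in>J. i \<noteq> j \<longrightarrow> hd (free_list T (P i)) \<notin> set (take k (free_list T (P j))))"

text \<open>
  Suppose that \<open>\<mu>\<close> gives the first free choice of \<open>j\<close> to another man \<open>i\<close> after \<open>s\<close>. By separation
  \<open>i\<close> gets none of his \<open>k\<close> first free choices, so \<open>k\<close> different men beat him there; but only
  \<open>g + 3 * L\<close> men can: the leaked ones and those close to the window.
\<close>

lemma card_not_first_choice_le:
  assumes P: "complete_lists M W P" and Q: "complete_lists W M Q"
    and PS: "\<And>m. m \<in> {1..M} \<Longrightarrow> set (P m) \<subseteq> {1..W}"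
    and near: "nearly_sorted M W L Q"
    and \<mu>: "stable_matching M W P Q \<mu>" and \<nu>: "stable_matching s W P Q \<nu>"
    and k: "k = g + 3 * L + 1"
    and sM: "s + g + L \<le> M" and sW: "s + k \<le> W"
    and sep: "separated {s<..s+g+L} k (snd ` \<nu>) P"
  shows "card {j \<in> {s<..s+g}. (j, hd (free_list (snd ` \<nu>) (P j))) \<notin> \<mu>} \<le> 2 * L"
proof -
  define T where "T = snd ` \<nu>"
  note mat = matchingD[OF stable_matchingD(1)[OF \<mu>]]
    and mat' = matchingD[OF stable_matchingD(1)[OF \<nu>]]
  note dP = complete_listsD[OF P]
  define K where "K = {i \<in> {1..s}. \<exists>w. w \<notin> T \<and> (i, w) \<in> \<mu>}"
  have cK: "card K \<le> L"
    unfolding K_def T_def using card_leaked_le[OF P Q near \<mu> \<nu>] sM sW by simp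
  have T: "finite T" "T \<subseteq> {1..W}" "card T \<le> s"
    unfolding T_def
    using mat'(2) finite_matching[OF stable_matchingD(1)[OF \<nu>]]
      card_matching_le(1)[OF stable_matchingD(1)[OF \<nu>]]
      card_image[OF matching_inj_on(2)[OF stable_matchingD(1)[OF \<nu>]]]
    by (blast, (clarify, simp only: snd_conv), simp)
  have fset: "set (free_list T (P j)) = {1..W} - T" if "j \<in> {1..M}" for j
  proof -
    have "set (P j) = {1..W}" by (rule equalityI[OF PS[OF that] dP(2)[OF that]])
    then show ?thesis by (simp only: set_filter set_diff_eq)
  qed
  have flen: "length (free_list T (P j)) \<ge> k" if "j \<in> {1..M}" for j
  proof -
    have "length (free_list T (P j)) = card (set (free_list T (P j)))"
      using distinct_card[of "free_list T (P j)"] dP(1)[OF that] by simp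
    also have "\<dots> = W - card T" unfolding fset[OF that] using T by (simp add: card_Diff_subset)
    finally show ?thesis using T sW by linarith
  qed
  define a where "a j = hd (free_list T (P j))" for j
  define top where "top j = set (take k (free_list T (P j)))" for j
  have ctop: "card (top j) = k" if "j \<in> {1..M}" for j
    unfolding top_def
    using distinct_card[of "take k (free_list T (P j))"] dP(1)[OF that] flen[OF that]
    by simp
  have top_sub: "top j \<subseteq> {1..W} - T" if "j \<in> {1..M}" for j
    unfolding top_def using fset[OF that] set_take_subset by metis
  have atop: "a j \<in> top j" if "j \<in> {1..M}" for j
    unfolding top_def a_def using flen[OF that] k
    by (cases "free_list T (P j)") auto
  have afirst: "prefers (P j) (a j) w" if "j \<in> {1..M}" "w \<in> {1..W}" "w \<notin> T" "w \<noteq> a j" for j w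
  proof -
    have "w \<in> set (free_list T (P j))" using fset that by auto
    then have "prefers (free_list T (P j)) (a j) w"
      using that(4) unfolding a_def by (cases "free_list T (P j)") (auto simp: prefers_Cons)
    then show ?thesis by (rule prefers_filter)
  qed
  have husband: "m' < m + L" if "m \<in> {1..M}" "m' \<in> {1..M}" "w \<in> {1..W}" "prefers (Q w) m' m" for m m' w
    using near that unfolding nearly_sorted_def by (meson not_le)
  \<comment> \<open>All men who can be preferred to \<open>i\<close> are among the first
    \<open>s + L\<close>, fewer than \<open>W\<close>.\<close>
  have matched: "\<exists>w. (i, w) \<in> \<mu>" if "i \<in> {1..s}" for i
  proof -
    have i: "i \<in> {1..M}" using that sM by auto
    have "\<And>m' w. w \<in> {1..W} \<Longrightarrow> m' \<in> {1..M} \<Longrightarrow> prefers (Q w) m' i \<Longrightarrow> m' \<in> {1..s+L}"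
      using husband[OF i] that by fastforce
    then show ?thesis
      using matched_if_card_lt[OF P Q \<mu> i, of "{1..s+L}"] sW k by fastforce
  qed
  text \<open>As many women of \<open>T\<close> go to later men as men up to \<open>s\<close> are matched outside \<open>T\<close>.\<close>
  define I where "I = {j. s < j \<and> (\<exists>w\<in>T. (j, w) \<in> \<mu>)}"
  have cI: "finite I" "card I \<le> L"
  proof -
    obtain h where h: "\<And>i. i \<in> {1..s} \<Longrightarrow> (i, h i) \<in> \<mu>" using matched by metis
    have inj: "inj_on h ({1..s} - K)" using h mat(4) by (intro inj_onI) (metis DiffD1)
    have sub: "h ` ({1..s} - K) \<subseteq> T" using h unfolding K_def by blast
    \<comment> \<open>The women of \<open>T\<close> not taken by the men up to \<open>s\<close> that
      stay inside \<open>T\<close>. As \<open>card T \<le> s\<close>, at most \<open>card K\<close>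
      of them are left for later men.\<close>
    define R where "R = T - h ` ({1..s} - K)"
    have "card R = card T - card ({1..s} - K)"
      unfolding R_def using sub T(1) card_image[OF inj] by (subst card_Diff_subset) auto
    also have "card ({1..s} - K) = s - card K"
      by (subst card_Diff_subset) (auto simp: K_def)
    finally have cR: "card R \<le> L" using T cK by linarith
    have "\<exists>w\<in>R. (j, w) \<in> \<mu>" if "j \<in> I" for j
    proof -
      obtain w where w: "w \<in> T" "(j, w) \<in> \<mu>" "s < j" using \<open>j \<in> I\<close> unfolding I_def by blast
      have "w \<noteq> h i" if "i \<in> {1..s}" for i
        using h[OF that] w mat(4) that by (metis atLeastAtMost_iff not_le)
      then have "w \<in> R" using w unfolding R_def by blast
      with w show ?thesis by blast
    qed
    then obtain u where u: "\<And>j. j \<in> I \<Longrightarrow> u j \<in> R \<and> (j, u j) \<in> \<mu>" by metis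
    have inju: "inj_on u I" using u mat(4) by (intro inj_onI) metis
    have finR: "finite R" using T(1) unfolding R_def by blast
    have ss: "u ` I \<subseteq> R" using u by blast
    show "finite I" using inj_on_finite[OF inju ss finR] .
    show "card I \<le> L" using card_inj_on_le[OF inju ss finR] cR by linarith
  qed
  define D where "D = {j \<in> {s<..s+g}. (j, a j) \<notin> \<mu>}"
  \<comment> \<open>The man \<open>j\<close> misses his first free choice and gets no woman of
    \<open>T\<close>, so \<open>a j\<close> is better than whatever he gets and must be held by a
    rival she prefers.\<close>
  have held: "\<exists>i\<in>K. (i, a j) \<in> \<mu>" if j: "j \<in> D - I" for j
  proof (rule ccontr)
    assume no: "\<not> (\<exists>i\<in>K. (i, a j) \<in> \<mu>)"
    have jM: "j \<in> {1..M}" "s < j" "j \<le> s + g" "(j, a j) \<notin> \<mu>" using j sM unfolding D_def by auto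
    have aW: "a j \<in> {1..W}" "a j \<notin> T" using atop top_sub jM(1) by blast+
    have "prefers (P j) (a j) v" if "(j, v) \<in> \<mu>" for v
    proof -
      have "v \<notin> T" using that j jM unfolding I_def by blast
      then show ?thesis using afirst[OF jM(1)] mat(2)[OF that] that jM(4) by blast
    qed
    then obtain i where i: "(i, a j) \<in> \<mu>" "prefers (Q (a j)) i j"
      using not_blocked_by[OF P Q \<mu> jM(1) aW(1) jM(4)] by blast
    have iM: "i \<in> {1..M}" using mat i by blast
    \<comment> \<open>A rival outside \<open>K\<close> comes after \<open>s\<close> and before
      \<open>j + L\<close>. This is why separation is required for \<open>L\<close> men beyond the
      \<open>g\<close> counted ones.\<close>
    have "i < j + L" using husband[OF jM(1) iM aW(1) i(2)] .
    have "i \<notin> K" using no i by blast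
    then have "i \<notin> {1..s}" unfolding K_def using i aW by blast
    with \<open>i < j + L\<close> jM iM have iJ: "i \<in> {s<..s+g+L}" by auto
    have "i \<noteq> j" using i jM by blast
    then have "a j \<notin> top i"
      using sep iJ jM unfolding separated_def T_def[symmetric] a_def top_def by auto
    then have better: "prefers (P i) w (a j)" if "w \<in> top i" for w
      using prefers_take[of w k "free_list T (P i)" "a j"] fset[OF iM] that aW
      unfolding top_def by (blast intro: prefers_filter)
    have "\<exists>m. (m, w) \<in> \<mu> \<and> m < i + L \<and> m \<in> {1..M}" if w: "w \<in> top i" for w
    proof -
      have wW: "w \<in> {1..W}" using top_sub[OF iM] w by blast
      have "(i, w) \<notin> \<mu>" using i(1) mat(3) w \<open>a j \<notin> top i\<close> by blast
      moreover have "prefers (P i) w v" if "(i, v) \<in> \<mu>" for v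
        using better[OF w] mat(3)[OF i(1) that] by simp
      ultimately obtain m where m: "(m, w) \<in> \<mu>" "prefers (Q w) m i"
        using not_blocked_by[OF P Q \<mu> iM wW] by blast
      then show ?thesis using husband[OF iM _ wW] mat(1) by blast
    qed
    then obtain q where q: "\<And>w. w \<in> top i \<Longrightarrow> (q w, w) \<in> \<mu> \<and> q w < i + L \<and> q w \<in> {1..M}" by metis
    have "inj_on q (top i)" using q mat(3) by (intro inj_onI) metis
    moreover have "q ` top i \<subseteq> K \<union> {s<..s+g+2*L}"
    proof clarify
      fix w assume w: "w \<in> top i" "q w \<notin> {s<..s+g+2*L}"
      have "q w \<in> {1..s}" using q[OF w(1)] w(2) iJ by auto
      moreover have "w \<notin> T" using top_sub[OF iM] w(1) by blast
      ultimately show "q w \<in> K" using q[OF w(1)] unfolding K_def by blast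
    qed
    ultimately have "card (top i) \<le> card (K \<union> {s<..s+g+2*L})"
      by (intro card_inj_on_le) (auto simp: K_def)
    also have "\<dots> \<le> card K + (g + 2 * L)" using card_Un_le[of K "{s<..s+g+2*L}"] by simp
    finally show False using ctop[OF iM] k cK by linarith
  qed
  have "\<exists>i. i \<in> K \<and> (i, a j) \<in> \<mu>" if "j \<in> D - I" for j using held[OF that] by blast
  then obtain r where r: "\<And>j. j \<in> D - I \<Longrightarrow> r j \<in> K \<and> (r j, a j) \<in> \<mu>" by metis
  \<comment> \<open>Since \<open>k\<close> is positive, separation makes the first free choices in
    the window pairwise different.\<close>
  have "inj_on r (D - I)"
  proof (rule inj_onI, rule ccontr)
    fix i j assume ij: "i \<in> D - I" "j \<in> D - I" "r i = r j" "i \<noteq> j"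
    then have "a i = a j" using r mat(3) by metis
    moreover have "i \<in> {s<..s+g+L}" "j \<in> {s<..s+g+L}" "j \<in> {1..M}"
      using ij sM unfolding D_def by auto
    ultimately show False
      using sep ij(4) atop[of j] unfolding separated_def T_def[symmetric] a_def top_def by metis
  qed
  then have "card (D - I) \<le> card K" using r by (intro card_inj_on_le[of r]) (auto simp: K_def)
  moreover have "card D \<le> card (D - I) + card I"
    using card_Un_le[of "D - I" I] card_mono[of "(D - I) \<union> I" D] cI by (auto simp: D_def)
  ultimately have "card D \<le> 2 * L" using cI cK by linarith
  then show ?thesis unfolding D_def a_def T_def .
qed

section \<open>Probability estimates for single lists\<close>

lemma prob_pair_pmf_le:
  assumes "\<And>y. y \<in> set_pmf q \<Longrightarrow> measure_pmf.prob p {x. (x, y) \<in> E} \<le> \<epsilon>"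
  shows "measure_pmf.prob (pair_pmf p q) E \<le> \<epsilon>"
proof -
  obtain y where "y \<in> set_pmf q" using set_pmf_not_empty[of q] by blast
  with assms have "0 \<le> \<epsilon>" using measure_nonneg order_trans by metis
  have "pair_pmf p q = q \<bind> (\<lambda>y. map_pmf (\<lambda>x. (x, y)) p)"
    unfolding pair_pmf_def map_pmf_def by (rule bind_commute_pmf)
  then have "emeasure (pair_pmf p q) E = (\<integral>\<^sup>+y. emeasure p {x. (x, y) \<in> E} \<partial>q)"
    by (simp add: emeasure_bind_pmf vimage_def)
  also have "\<dots> \<le> (\<integral>\<^sup>+y. ennreal \<epsilon> \<partial>q)"
    by (intro nn_integral_mono_AE)
       (auto simp: AE_measure_pmf_iff measure_pmf.emeasure_eq_measure intro!: ennreal_leI assms)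
  finally show ?thesis
    using \<open>0 \<le> \<epsilon>\<close> by (simp add: measure_pmf.emeasure_eq_measure)
qed

lemma prob_pair_pmf_le':
  assumes "\<And>x. x \<in> set_pmf p \<Longrightarrow> measure_pmf.prob q {y. (x, y) \<in> E} \<le> \<epsilon>"
  shows "measure_pmf.prob (pair_pmf p q) E \<le> \<epsilon>"
proof -
  have "measure_pmf.prob (pair_pmf p q) E = measure_pmf.prob (pair_pmf q p) {(y, x). (x, y) \<in> E}"
    by (subst pair_commute_pmf) (simp add: vimage_def case_prod_beta)
  also have "\<dots> \<le> \<epsilon>" by (rule prob_pair_pmf_le) (use assms in simp)
  finally show ?thesis .
qed

text \<open>Draws the component \<open>x\<close> last: it suffices to bound the conditional
  probability for each fixed choice \<open>f\<close> of the others.\<close>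

lemma prob_Pi_pmf_le:
  assumes "finite I" "x \<in> I"
    and "\<And>f. f \<in> set_pmf (Pi_pmf (I - {x}) d p) \<Longrightarrow> measure_pmf.prob (p x) {a. f(x := a) \<in> E} \<le> \<epsilon>"
  shows "measure_pmf.prob (Pi_pmf I d p) E \<le> \<epsilon>"
proof -
  have "Pi_pmf I d p = Pi_pmf (insert x (I - {x})) d p"
    using \<open>x \<in> I\<close> by (simp add: insert_absorb)
  also have "\<dots> = map_pmf (\<lambda>(y, f). f(x := y)) (pair_pmf (p x) (Pi_pmf (I - {x}) d p))"
    using \<open>finite I\<close> by (intro Pi_pmf_insert) auto
  finally show ?thesis
    using assms(3) by (simp add: prob_pair_pmf_le)
qed

text \<open>Deleting \<open>T\<close> from a uniform ordering of \<open>S\<close> leaves a uniform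
  ordering of \<open>S - T\<close>, whose head is uniform on \<open>S - T\<close>. Strictness of
  \<open>T \<subset> S\<close> keeps the filtered list nonempty, so that \<open>hd\<close> is
  meaningful.\<close>

lemma prob_first_free_le:
  assumes "finite S" "T \<subset> S" "finite K"
  shows "measure_pmf.prob (pmf_of_set (permutations_of_set S))
           {l. hd (filter (\<lambda>w. w \<notin> T) l) \<in> K} \<le> card K / card (S - T)"
proof -
  define C where "C = {w \<in> S. w \<notin> T}"
  have C: "finite C" "C \<noteq> {}" "C = S - T" using assms by (auto simp: C_def)
  have "map_pmf (\<lambda>l. filter (\<lambda>w. w \<notin> T) l) (pmf_of_set (permutations_of_set S)) =
      map_pmf fst (map_pmf (partition (\<lambda>w. w \<notin> T)) (pmf_of_set (permutations_of_set S)))"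
    by (simp add: pmf.map_comp o_def)
  also have "\<dots> = pmf_of_set (permutations_of_set C)"
    unfolding partition_random_permutations[OF assms(1)] map_fst_pair_pmf C_def ..
  finally have 1: "map_pmf (\<lambda>l. filter (\<lambda>w. w \<notin> T) l) (pmf_of_set (permutations_of_set S)) =
      pmf_of_set (permutations_of_set C)" .
  have 2: "map_pmf hd (pmf_of_set (permutations_of_set C)) = pmf_of_set C"
    unfolding random_permutation_of_set[OF C(1,2)]
    by (simp add: map_bind_pmf pmf.map_comp o_def bind_return_pmf' flip: map_pmf_def)
  have "measure_pmf.prob (pmf_of_set (permutations_of_set S)) {l. hd (filter (\<lambda>w. w \<notin> T) l) \<in> K} =
      measure_pmf.prob (map_pmf hd (map_pmf (\<lambda>l. filter (\<lambda>w. w \<notin> T) l)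
        (pmf_of_set (permutations_of_set S)))) K"
    by (simp add: vimage_def)
  also have "\<dots> = measure_pmf.prob (pmf_of_set C) K" unfolding 1 2 ..
  also have "\<dots> = card (C \<inter> K) / card C" using C by (simp add: measure_pmf_of_set)
  also have "\<dots> \<le> card K / card C"
    using assms(3) by (intro divide_right_mono of_nat_mono card_mono) auto
  finally show ?thesis using C by simp
qed

text \<open>The denominator of the ratio is a probability, hence at most 1, so the ratio dominates
  its numerator.\<close>

lemma prob_prefers_le:
  assumes "max_pref_ratio M W D k \<le> ennreal r" "0 \<le> r" "w \<in> {1..W}" "1 \<le> i" "i + k \<le> M"
  shows "measure_pmf.prob (D w) {l. prefers l (i + k) i} \<le> r"
proof -
  define a where "a = measure_pmf.prob (D w) {l. prefers l (i + k) i}"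
  define b where "b = measure_pmf.prob (D w) {l. prefers l i (i + k)}"
  have ab: "0 \<le> a" "0 \<le> b" "b \<le> 1" by (simp_all add: a_def b_def)
  have "ennreal a \<le> ennreal a / ennreal b"
  \<comment> \<open>For \<open>b = 0\<close> the quotient in \<open>ennreal\<close> is infinite, or
    \<open>0\<close> when \<open>a = 0\<close>; the inequality holds in both cases.\<close>
  proof (cases "b = 0")
    case True
    then show ?thesis
      using ab by (cases "a = 0") (simp_all add: divide_ennreal_def ennreal_mult_top)
  next
    case False
    then have "a \<le> a / b" using ab by (simp add: le_divide_eq mult_left_le)
    with False ab show ?thesis by (simp add: divide_ennreal)
  qed
  also have "\<dots> \<le> max_pref_ratio M W D k"
    unfolding max_pref_ratio_def using assms(3-5)
    by (intro SUP_upper2[of "(w, i)"]) (auto simp: a_def b_def measure_pmf.emeasure_eq_measure)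
  also have "\<dots> \<le> ennreal r" by fact
  finally show ?thesis
    using \<open>0 \<le> r\<close> by (simp add: a_def)
qed

text \<open>Union bound over all triples \<open>(w, i, j)\<close> with \<open>i + L \<le> j\<close>,
  using the ratio at distance \<open>j - i\<close>; \<open>L \<ge> 1\<close> makes that distance
  positive.\<close>

lemma prob_not_nearly_sorted_le:
  assumes ratio: "\<And>k. k \<ge> 1 \<Longrightarrow> max_pref_ratio M W D k \<le> ennreal (A * exp (- c * real k))"
    and "A > 0" "c > 0" "L \<ge> 1"
  shows "measure_pmf.prob (Pi_pmf {1..W} [] D) {Q. \<not> nearly_sorted M W L Q}
           \<le> real W * real M ^ 2 * (A * exp (- c * real L))"
proof -
  define Z where "Z = {(w, i, j). w \<in> {1..W} \<and> i \<in> {1..M} \<and> j \<in> {1..M} \<and> i + L \<le> j}"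
  define bad where "bad = (\<lambda>(w, i, j). {Q :: nat \<Rightarrow> nat list. prefers (Q w) j i})"
  have Z: "Z \<subseteq> {1..W} \<times> {1..M} \<times> {1..M}" "finite Z"
    by (auto simp: Z_def intro: finite_subset[of _ "{1..W} \<times> {1..M} \<times> {1..M}"])
  have one: "measure_pmf.prob (Pi_pmf {1..W} [] D) (bad z) \<le> A * exp (- c * real L)" if "z \<in> Z" for z
  proof -
    obtain w i j where z: "z = (w, i, j)" by (cases z)
    with that have r: "w \<in> {1..W}" "1 \<le> i" "i + (j - i) \<le> M" "i + L \<le> j" by (auto simp: Z_def)
    have "measure_pmf.prob (Pi_pmf {1..W} [] D) (bad z) =
        measure_pmf.prob (map_pmf (\<lambda>Q. Q w) (Pi_pmf {1..W} [] D)) {l. prefers l j i}"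
      by (simp add: z bad_def vimage_def)
    also have "\<dots> = measure_pmf.prob (D w) {l. prefers l (i + (j - i)) i}"
      using r by (subst Pi_pmf_component) auto
    also have "\<dots> \<le> A * exp (- c * real (j - i))"
      using r \<open>A > 0\<close> \<open>L \<ge> 1\<close> by (intro prob_prefers_le[OF ratio]) auto
    also have "\<dots> \<le> A * exp (- c * real L)"
      using r \<open>A > 0\<close> \<open>c > 0\<close> by simp
    finally show ?thesis .
  qed
  have "{Q. \<not> nearly_sorted M W L Q} \<subseteq> (\<Union>z\<in>Z. bad z)"
    unfolding nearly_sorted_def Z_def bad_def by fastforce
  then have "measure_pmf.prob (Pi_pmf {1..W} [] D) {Q. \<not> nearly_sorted M W L Q}
      \<le> measure_pmf.prob (Pi_pmf {1..W} [] D) (\<Union>z\<in>Z. bad z)"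
    by (intro measure_pmf.finite_measure_mono) auto
  also have "\<dots> \<le> (\<Sum>z\<in>Z. measure_pmf.prob (Pi_pmf {1..W} [] D) (bad z))"
    by (intro measure_pmf.finite_measure_subadditive_finite Z) auto
  also have "\<dots> \<le> real (card Z) * (A * exp (- c * real L))"
    using one by (rule sum_bounded_above)
  also have "\<dots> \<le> real (W * (M * M)) * (A * exp (- c * real L))"
    using card_mono[OF _ Z(1)] \<open>A > 0\<close> by (intro mult_right_mono of_nat_mono) (auto simp: card_cartesian_product)
  finally show ?thesis by (simp add: power2_eq_square)
qed

section \<open>Separation of the free choices in a window\<close>

text \<open>Any stable matching of the first \<open>s\<close> men would do. Fixing one by choice
  turns the set into a function of the lists, to which probabilities can refer.\<close>

definition occupied :: "nat \<Rightarrow> (nat \<Rightarrow> nat list) \<Rightarrow> (nat \<Rightarrow> nat list) \<Rightarrow> nat \<Rightarrow> nat set" where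
  "occupied W P Q s = snd ` (SOME \<nu>. stable_matching s W P Q \<nu>)"

text \<open>Both sides apply \<open>SOME\<close> to the same predicate. Hence the set is already
  determined when the lists of the men after \<open>s\<close> are drawn.\<close>

lemma occupied_cong:
  assumes "\<And>i. i \<in> {1..s} \<Longrightarrow> P i = P' i"
  shows "occupied W P Q s = occupied W P' Q s"
proof -
  have "blocks P Q \<nu> m w = blocks P' Q \<nu> m w" if "m \<in> {1..s}" for \<nu> m w
    using assms[OF that] by (simp add: blocks_def)
  then have "stable_matching s W P Q = stable_matching s W P' Q"
    by (auto simp: stable_matching_def fun_eq_iff)
  then show ?thesis by (simp add: occupied_def)
qed

lemma occupied_stable:
  assumes "complete_lists s W P" "complete_lists W s Q"
  obtains \<nu> where "stable_matching s W P Q \<nu>" "occupied W P Q s = snd ` \<nu>"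
  using someI_ex[OF ex_stable_matching[OF assms]] unfolding occupied_def by blast

lemma card_occupied_le:
  assumes "complete_lists s W P" "complete_lists W s Q"
  shows "card (occupied W P Q s) \<le> s" "occupied W P Q s \<subseteq> {1..W}"
proof -
  obtain \<nu> where \<nu>: "stable_matching s W P Q \<nu>" "occupied W P Q s = snd ` \<nu>"
    using occupied_stable[OF assms] .
  note mat = stable_matchingD(1)[OF \<nu>(1)]
  show "card (occupied W P Q s) \<le> s"
    unfolding \<nu>(2) card_image[OF matching_inj_on(2)[OF mat]] by (rule card_matching_le(1)[OF mat])
  show "occupied W P Q s \<subseteq> {1..W}"
    unfolding \<nu>(2) using matchingD(2)[OF mat] by auto
qed

abbreviation uniform_lists :: "nat \<Rightarrow> nat \<Rightarrow> (nat \<Rightarrow> nat list) pmf" where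
  "uniform_lists M W \<equiv> Pi_pmf {1..M} [] (\<lambda>_. pmf_of_set (permutations_of_set {1..W}))"

text \<open>Union bound over the at most \<open>h ^ 2\<close> ordered pairs \<open>(i, j)\<close>.
  With the list of \<open>i\<close> drawn last, the occupied set and the top \<open>k\<close> free
  choices of \<open>j\<close> are fixed, while the first free choice of \<open>i\<close> is uniform
  on at least \<open>W - s\<close> women.\<close>

lemma prob_not_separated_le:
  assumes Q: "complete_lists W M Q" and "s + h \<le> M" "s < W"
  shows "measure_pmf.prob (uniform_lists M W) {P. \<not> separated {s<..s+h} k (occupied W P Q s) P}
           \<le> real h ^ 2 * (real k / real (W - s))"
proof -
  define J where "J = {s<..s+h}"
  define Z where "Z = {(i, j). i \<in> J \<and> j \<in> J \<and> i \<noteq> j}"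
  define bad where "bad = (\<lambda>(i, j). {P. hd (free_list (occupied W P Q s) (P i))
      \<in> set (take k (free_list (occupied W P Q s) (P j)))})"
  have Z: "Z \<subseteq> J \<times> J" "finite Z"
    by (auto simp: Z_def J_def intro: finite_subset[of _ "J \<times> J"])
  have one: "measure_pmf.prob (uniform_lists M W) (bad z) \<le> real k / real (W - s)" if "z \<in> Z" for z
  proof -
    obtain i j where z: "z = (i, j)" by (cases z)
    with that have r: "i \<in> J" "j \<in> J" "i \<noteq> j" by (auto simp: Z_def)
    have "i \<in> {1..M}" using r \<open>s + h \<le> M\<close> by (auto simp: J_def)
    show ?thesis
    proof (rule prob_Pi_pmf_le[OF _ \<open>i \<in> {1..M}\<close>])
      fix f assume f: "f \<in> set_pmf (Pi_pmf ({1..M} - {i}) [] (\<lambda>_. pmf_of_set (permutations_of_set {1..W})))"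
      have "f m \<in> permutations_of_set {1..W}" if "m \<in> {1..s}" for m
      proof -
        have "m \<in> {1..M} - {i}" using that r \<open>s + h \<le> M\<close> by (auto simp: J_def)
        then show ?thesis using f by (auto simp: set_Pi_pmf PiE_dflt_def)
      qed
      then have "complete_lists s W f"
        unfolding complete_lists_def by (auto simp: permutations_of_set_def)
      moreover have "complete_lists W s Q"
        using complete_lists_mono[OF Q] \<open>s + h \<le> M\<close> by simp
      ultimately have T: "card (occupied W f Q s) \<le> s" "occupied W f Q s \<subseteq> {1..W}"
        by (rule card_occupied_le)+
      define T where "T = occupied W f Q s"
      define K where "K = set (take k (free_list T (f j)))"
      \<comment> \<open>The man \<open>i\<close> comes after \<open>s\<close>, so his list does not
        influence the occupied set.\<close>
      have eq: "occupied W (f(i := a)) Q s = T" for a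
        unfolding T_def using r by (intro occupied_cong) (auto simp: J_def)
      have "measure_pmf.prob (pmf_of_set (permutations_of_set {1..W})) {a. f(i := a) \<in> bad z}
          = measure_pmf.prob (pmf_of_set (permutations_of_set {1..W})) {a. hd (free_list T a) \<in> K}"
        using r by (simp add: z bad_def eq K_def)
      also have "\<dots> \<le> card K / card ({1..W} - T)"
        using T \<open>s < W\<close> by (intro prob_first_free_le) (auto simp: T_def K_def)
      also have "\<dots> \<le> real k / real (W - s)"
      proof (intro frac_le of_nat_mono)
        show "card K \<le> k" unfolding K_def
          by (rule order_trans[OF card_length]) simp
        show "W - s \<le> card ({1..W} - T)"
          using diff_card_le_card_Diff[of T "{1..W}"] T finite_subset[OF T(2)] by (simp add: T_def)
      qed (use \<open>s < W\<close> in auto)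
      finally show "measure_pmf.prob (pmf_of_set (permutations_of_set {1..W})) {a. f(i := a) \<in> bad z}
          \<le> real k / real (W - s)" .
    qed simp
  qed
  have "{P. \<not> separated {s<..s+h} k (occupied W P Q s) P} \<subseteq> (\<Union>z\<in>Z. bad z)"
    unfolding separated_def Z_def bad_def J_def by fastforce
  then have "measure_pmf.prob (uniform_lists M W) {P. \<not> separated {s<..s+h} k (occupied W P Q s) P}
      \<le> measure_pmf.prob (uniform_lists M W) (\<Union>z\<in>Z. bad z)"
    by (intro measure_pmf.finite_measure_mono) auto
  also have "\<dots> \<le> (\<Sum>z\<in>Z. measure_pmf.prob (uniform_lists M W) (bad z))"
    by (intro measure_pmf.finite_measure_subadditive_finite Z) auto
  also have "\<dots> \<le> real (card Z) * (real k / real (W - s))"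
    using one by (rule sum_bounded_above)
  also have "\<dots> \<le> real (h * h) * (real k / real (W - s))"
    using card_mono[OF _ Z(1)]
    by (intro mult_right_mono of_nat_mono) (auto simp: card_cartesian_product J_def)
  finally show ?thesis by (simp add: power2_eq_square)
qed

section \<open>Summation over disjoint windows\<close>

lemma fraction_multiple_bounds:
  "fraction_multiple M W P Q \<le> 1" "0 \<le> fraction_multiple M W P Q"
proof -
  have divide_le_1: "a / b \<le> 1" if "0 \<le> a" "a \<le> b" for a b :: real
    unfolding divide_le_eq_1 using that by linarith
  have le: "card {x \<in> {1..n}. R x} \<le> n" for n :: nat and R
    using card_mono[of "{1..n}" "{x \<in> {1..n}. R x}"] by (metis (no_types, lifting) card_atLeastAtMost diff_Suc_1 finite_atLeastAtMost mem_Collect_eq subsetI)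
  show "fraction_multiple M W P Q \<le> 1" "0 \<le> fraction_multiple M W P Q"
    unfolding fraction_multiple_def
    by (rule divide_le_1; use add_mono[OF le le] in \<open>simp only: of_nat_0_le_iff of_nat_le_iff\<close>) simp
qed

text \<open>The \<open>g\<close> men of block \<open>r\<close> and the \<open>L\<close> men behind
  them, the only later ones who can compete with the block when the women are nearly sorted.\<close>

definition window :: "nat \<Rightarrow> nat \<Rightarrow> nat \<Rightarrow> nat set" where
  "window g L r = {r * g<..r * g + g + L}"

text \<open>In a separated window at most \<open>2 * L\<close> men miss their first free choice in
  each optimal matching, so all but \<open>4 * L\<close> of the \<open>g\<close> men have the same
  wife in both. A window that is not separated is given up entirely. The reserve \<open>R\<close>
  ensures that even the last window has enough men and women after it.\<close>

lemma fraction_multiple_window_le: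
  fixes n g L R :: nat
  assumes P: "complete_lists M W P" and Q: "complete_lists W M Q"
    and PS: "\<And>m. m \<in> {1..M} \<Longrightarrow> set (P m) \<subseteq> {1..W}"
    and near: "nearly_sorted M W L Q"
    and N: "n * g + R \<le> min M W" and R: "g + 3 * L + 1 \<le> R"
    and gL: "4 * L \<le> g"
  shows "fraction_multiple M W P Q \<le> (real (min M W) - real n * (real g - 4 * real L) +
      (\<Sum>r<n. real g * of_bool (\<not> separated (window g L r) (g + 3 * L + 1)
         (occupied W P Q (r * g)) P))) / real (min M W)"
proof -
  define k where "k = g + 3 * L + 1"
  define sep where "sep r \<longleftrightarrow> separated (window g L r) k (occupied W P Q (r * g)) P" for r
  obtain \<mu> \<nu> where \<mu>: "stable_matching M W P Q \<mu>" and \<nu>: "stable_matching M W P Q \<nu>"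
    and frac: "fraction_multiple M W P Q \<le> 2 * (real (min M W) - real (card (\<mu> \<inter> \<nu>))) / real (M + W)"
    using fraction_multiple_le[OF P Q] .
  define I where "I = {j. \<exists>w. (j, w) \<in> \<mu> \<inter> \<nu>}"
  have fin: "finite (\<mu> \<inter> \<nu>)" using finite_matching[OF stable_matchingD(1)[OF \<mu>]] by blast
  have "I = fst ` (\<mu> \<inter> \<nu>)" unfolding I_def by force
  then have I: "finite I" "card I \<le> card (\<mu> \<inter> \<nu>)" using fin card_image_le by auto
  have le: "card (\<mu> \<inter> \<nu>) \<le> min M W"
    using card_matching_le[OF stable_matchingD(1)[OF \<mu>]]
      card_mono[OF finite_matching[OF stable_matchingD(1)[OF \<mu>]], of "\<mu> \<inter> \<nu>"] by force
  \<comment> \<open>Men are numbered from 1; the shift by \<open>Suc\<close> turns the blocks into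
    intervals starting at 0, as \<open>sum.nat_group\<close> expects.\<close>
  have win: "real g - 4 * real L - real g * of_bool (\<not> sep r)
      \<le> (\<Sum>j = r * g..<r * g + g. of_bool (Suc j \<in> I))" if "r < n" for r
  proof (cases "sep r")
    case True
    define s where "s = r * g"
    have "Suc r * g \<le> n * g" using that by (intro mult_right_mono) auto
    then have sg: "s + g \<le> n * g" by (simp add: s_def)
    have sM: "s + g + L \<le> M" and sW: "s + k \<le> W" using sg N R by (auto simp: k_def)
    have "complete_lists s W P" "complete_lists W s Q"
      using complete_lists_mono P Q sM by (metis add_leD1 order_refl)+
    then obtain \<rho> where \<rho>: "stable_matching s W P Q \<rho>" "occupied W P Q s = snd ` \<rho>"
      using occupied_stable by blast
    define a where "a j = hd (free_list (snd ` \<rho>) (P j))" for j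
    have S: "separated {s<..s+g+L} k (snd ` \<rho>) P"
      using True \<rho> unfolding sep_def window_def s_def by simp
    have c: "card {j \<in> {s<..s+g}. (j, a j) \<notin> \<mu>} \<le> 2 * L" "card {j \<in> {s<..s+g}. (j, a j) \<notin> \<nu>} \<le> 2 * L"
      unfolding a_def
      using card_not_first_choice_le[OF P Q PS near \<mu> \<rho>(1) k_def sM sW S]
        card_not_first_choice_le[OF P Q PS near \<nu> \<rho>(1) k_def sM sW S] by blast+
    have "{s<..s+g} \<subseteq> (I \<inter> {s<..s+g}) \<union> {j \<in> {s<..s+g}. (j, a j) \<notin> \<mu>} \<union> {j \<in> {s<..s+g}. (j, a j) \<notin> \<nu>}"
      unfolding I_def by blast
    then have "card {s<..s+g} \<le> card ((I \<inter> {s<..s+g}) \<union> {j \<in> {s<..s+g}. (j, a j) \<notin> \<mu>} \<union> {j \<in> {s<..s+g}. (j, a j) \<notin> \<nu>})"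
      by (intro card_mono) auto
    also have "\<dots> \<le> card (I \<inter> {s<..s+g}) + card {j \<in> {s<..s+g}. (j, a j) \<notin> \<mu>} + card {j \<in> {s<..s+g}. (j, a j) \<notin> \<nu>}"
      by (intro order_trans[OF card_Un_le] add_mono card_Un_le order_refl)
    finally have "g \<le> card (I \<inter> {s<..s+g}) + 4 * L" using c by simp
    moreover have "(\<Sum>j = s..<s + g. of_bool (Suc j \<in> I)) = real (card (I \<inter> {s<..s+g}))"
    proof -
      have "(\<Sum>j = s..<s + g. of_bool (Suc j \<in> I)) = real (card ({s..<s + g} \<inter> {j. Suc j \<in> I}))"
        by (subst sum_of_bool_eq) auto
      also have "{s..<s + g} \<inter> {j. Suc j \<in> I} = {j. Suc j \<in> I \<inter> {s<..s+g}}" by auto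
      also have "card \<dots> = card (Suc ` \<dots>)" by (simp add: card_image)
      also have "Suc ` {j. Suc j \<in> I \<inter> {s<..s+g}} = I \<inter> {s<..s+g}"
      proof (intro equalityI subsetI)
        fix j assume j: "j \<in> I \<inter> {s<..s+g}"
        then have "j = Suc (j - 1)" by simp
        with j show "j \<in> Suc ` {j. Suc j \<in> I \<inter> {s<..s+g}}" by (metis (mono_tags) imageI mem_Collect_eq)
      qed blast
      finally show ?thesis .
    qed
    ultimately show ?thesis using True by (simp add: s_def)
  next
    case False
    have "(0::real) \<le> (\<Sum>j = r * g..<r * g + g. of_bool (Suc j \<in> I))" by (intro sum_nonneg) auto
    with False show ?thesis by simp
  qed
  have "real n * (real g - 4 * real L) - (\<Sum>r<n. real g * of_bool (\<not> sep r))
      = (\<Sum>r<n. real g - 4 * real L - real g * of_bool (\<not> sep r))"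
    by (simp add: sum_subtractf)
  also have "\<dots> \<le> (\<Sum>r<n. \<Sum>j = r * g..<r * g + g. of_bool (Suc j \<in> I))"
    using win by (intro sum_mono) auto
  also have "\<dots> = (\<Sum>j<n * g. of_bool (Suc j \<in> I))" by (rule sum.nat_group)
  also have "\<dots> = real (card (Suc ` ({..<n * g} \<inter> {j. Suc j \<in> I})))"
    by (subst sum_of_bool_eq) (auto simp: card_image)
  also have "\<dots> \<le> real (card I)" using I(1) by (intro of_nat_mono card_mono) auto
  also have "\<dots> \<le> real (card (\<mu> \<inter> \<nu>))" using I(2) by simp
  finally have X: "real n * (real g - 4 * real L) - (\<Sum>r<n. real g * of_bool (\<not> sep r))
      \<le> real (card (\<mu> \<inter> \<nu>))" .
  have pos: "0 < min M W" using N R by linarith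
  \<comment> \<open>Here \<open>M + W\<close> is at least twice the minimum, which cancels the
    factor 2.\<close>
  have "fraction_multiple M W P Q \<le> 2 * (real (min M W) - real (card (\<mu> \<inter> \<nu>))) / (2 * real (min M W))"
    using pos le by (intro order_trans[OF frac] divide_left_mono) auto
  also have "\<dots> = (real (min M W) - real (card (\<mu> \<inter> \<nu>))) / real (min M W)"
    by (rule mult_divide_mult_cancel_left) simp
  also have "\<dots> \<le> (real (min M W) - real n * (real g - 4 * real L) + (\<Sum>r<n. real g * of_bool (\<not> sep r)))
      / real (min M W)"
    using X by (intro divide_right_mono) auto
  finally show ?thesis unfolding sep_def k_def .
qed

section \<open>Bounds for the expected fraction\<close>

lemma expectation_le_sum_prob:
  fixes f :: "'a \<Rightarrow> real"
  assumes "finite I" "\<And>x. 0 \<le> f x \<and> f x \<le> B"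
    and "\<And>x. x \<in> set_pmf p \<Longrightarrow> f x \<le> C + (\<Sum>i\<in>I. b i * indicator (Y i) x)"
  shows "measure_pmf.expectation p f \<le> C + (\<Sum>i\<in>I. b i * measure_pmf.prob p (Y i))"
proof -
  have int: "integrable (measure_pmf p) (\<lambda>x. b i * indicator (Y i) x)" for i
    by (intro measure_pmf.integrable_const_bound[of _ "\<bar>b i\<bar>"]) (auto simp: indicator_def)
  have "measure_pmf.expectation p f \<le> measure_pmf.expectation p (\<lambda>x. C + (\<Sum>i\<in>I. b i * indicator (Y i) x))"
  proof (rule integral_mono_AE)
    show "integrable (measure_pmf p) f"
      using assms(2) by (intro measure_pmf.integrable_const_bound[of _ B]) auto
    show "AE x in measure_pmf p. f x \<le> C + (\<Sum>i\<in>I. b i * indicator (Y i) x)"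
      using assms(3) by (simp add: AE_measure_pmf_iff)
  qed (intro Bochner_Integration.integrable_add Bochner_Integration.integrable_sum int; simp)
  also have "\<dots> = C + measure_pmf.expectation p (\<lambda>x. \<Sum>i\<in>I. b i * indicator (Y i) x)"
    by (subst Bochner_Integration.integral_add)
       (intro Bochner_Integration.integrable_sum int | simp)+
  also have "\<dots> = C + (\<Sum>i\<in>I. b i * measure_pmf.prob p (Y i))"
    by (subst Bochner_Integration.integral_sum) (rule int, simp)
  finally show ?thesis .
qed

lemma complete_lists_permutations:
  assumes "P \<in> set_pmf (Pi_pmf {1..m} d p)"
    and "\<And>i. i \<in> {1..m} \<Longrightarrow> set_pmf (p i) \<subseteq> permutations_of_set {1..n}"
  shows "complete_lists m n P" "i \<in> {1..m} \<Longrightarrow> set (P i) = {1..n}"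
proof -
  have *: "P i \<in> permutations_of_set {1..n}" if "i \<in> {1..m}" for i
    using assms that by (auto simp: set_Pi_pmf PiE_dflt_def)
  then show "i \<in> {1..m} \<Longrightarrow> set (P i) = {1..n}"
    by (simp add: permutations_of_set_def)
  show "complete_lists m n P"
    using * unfolding complete_lists_def permutations_of_set_def by auto
qed

lemma random_instanceD:
  assumes "(P, Q) \<in> set_pmf (random_instance M W D)"
    and "\<forall>w\<in>{1..W}. set_pmf (D w) \<subseteq> permutations_of_set {1..M}"
  shows "complete_lists M W P" "complete_lists W M Q"
    "\<And>m. m \<in> {1..M} \<Longrightarrow> set (P m) \<subseteq> {1..W}"
proof -
  have P: "P \<in> set_pmf (uniform_lists M W)" and Q: "Q \<in> set_pmf (Pi_pmf {1..W} [] D)"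
    using assms(1) by (auto simp: random_instance_def)
  show "complete_lists M W P" "\<And>m. m \<in> {1..M} \<Longrightarrow> set (P m) \<subseteq> {1..W}"
    using complete_lists_permutations[OF P, of W] by auto
  show "complete_lists W M Q"
    using complete_lists_permutations[OF Q] assms(2) by blast
qed

text \<open>Only matched persons count, at most \<open>min M W\<close> on each side. This settles
  very unbalanced instances, where the union bound over all women and pairs of men is too
  weak.\<close>

lemma expected_fraction_le_sizes:
  assumes supp: "\<forall>w\<in>{1..W}. set_pmf (D w) \<subseteq> permutations_of_set {1..M}"
  shows "expected_fraction M W D \<le> 2 * real (min M W) / real (M + W)"
proof -
  have "measure_pmf.expectation (random_instance M W D) (\<lambda>(P, Q). fraction_multiple M W P Q)
      \<le> 2 * real (min M W) / real (M + W) +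
        (\<Sum>i\<in>{}. 0 * measure_pmf.prob (random_instance M W D) {})"
  proof (rule expectation_le_sum_prob, goal_cases)
    case (3 x)
    obtain P Q where x: "x = (P, Q)" by (cases x)
    obtain \<mu> \<nu> where "fraction_multiple M W P Q
        \<le> 2 * (real (min M W) - real (card (\<mu> \<inter> \<nu> :: (nat \<times> nat) set))) / real (M + W)"
      using fraction_multiple_le[OF random_instanceD(1,2)] 3 supp unfolding x by metis
    also have "\<dots> \<le> 2 * real (min M W) / real (M + W)"
      by (intro divide_right_mono) auto
    finally show ?case by (simp add: x)
  qed (auto intro: fraction_multiple_bounds)
  then show ?thesis by (simp add: expected_fraction_def)
qed

lemma expected_fraction_nonneg: "0 \<le> expected_fraction M W D"
  unfolding expected_fraction_def
  by (intro Bochner_Integration.integral_nonneg) (auto simp: fraction_multiple_bounds)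

text \<open>The three terms are the men never covered by the window count, the event that the women
  are not nearly sorted, and the expected loss from windows that are not separated.\<close>

lemma expected_fraction_le:
  fixes n g L R :: nat
  assumes supp: "\<forall>w\<in>{1..W}. set_pmf (D w) \<subseteq> permutations_of_set {1..M}"
    and ratio: "\<And>k. k \<ge> 1 \<Longrightarrow> max_pref_ratio M W D k \<le> ennreal (A * exp (- c * real k))"
    and A: "A > 0" and c: "c > 0" and L: "L \<ge> 1"
    and N: "n * g + R \<le> min M W" and R: "g + 3 * L + 1 \<le> R" and gL: "4 * L \<le> g"
  shows "expected_fraction M W D \<le> (real (min M W) - real n * (real g - 4 * real L)) / real (min M W) +
     real W * real M ^ 2 * (A * exp (- c * real L)) +
     real n * real g / real (min M W) * (real (g + L) ^ 2 * real (g + 3 * L + 1) / real R)"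
proof -
  define k where "k = g + 3 * L + 1"
  define p where "p = random_instance M W D"
  define N' where "N' = real (min M W)"
  have N'pos: "N' > 0" unfolding N'_def using N R by auto
  define C where "C = (N' - real n * (real g - 4 * real L)) / N'"
  \<comment> \<open>One family holds all bad events: the indices below \<open>n\<close> are the
    windows, each costing \<open>g\<close> men, and index \<open>n\<close> is the failure of near
    sortedness, costing everything.\<close>
  define Y where "Y r = (if r = n then {(P, Q). \<not> nearly_sorted M W L Q}
     else {(P, Q). \<not> separated (window g L r) k (occupied W P Q (r * g)) P})" for r
  define b where "b r = (if r = n then 1 else real g / N')" for r
  have "real n * (real g - 4 * real L) \<le> real n * real g" by (intro mult_left_mono) auto
  also have "\<dots> \<le> N'" unfolding N'_def of_nat_mult[symmetric] using N by linarith
  finally have C0: "0 \<le> C" unfolding C_def using N'pos by simp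
  have b0: "0 \<le> b r" for r using N'pos by (simp add: b_def)
  have "measure_pmf.expectation p (\<lambda>(P, Q). fraction_multiple M W P Q)
      \<le> C + (\<Sum>r\<in>{..n}. b r * measure_pmf.prob p (Y r))"
  proof (rule expectation_le_sum_prob, goal_cases)
    case (3 x)
    obtain P Q where x: "x = (P, Q)" by (cases x)
    note PQ = random_instanceD[OF _ supp, of P Q]
    have inst: "(P, Q) \<in> set_pmf (random_instance M W D)" using 3 by (simp add: x p_def)
    show ?case
    proof (cases "nearly_sorted M W L Q")
      case True
      have "fraction_multiple M W P Q \<le> (N' - real n * (real g - 4 * real L) +
          (\<Sum>r<n. real g * of_bool (\<not> separated (window g L r) k (occupied W P Q (r * g)) P))) / N'"
        unfolding N'_def k_def
        by (rule fraction_multiple_window_le[OF PQ(1)[OF inst] PQ(2)[OF inst] PQ(3)[OF inst] True N R gL])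
      also have "\<dots> = C + (\<Sum>r<n. b r * indicator (Y r) x)"
        unfolding C_def add_divide_distrib sum_divide_distrib
        by (intro arg_cong2[where f = "(+)"] sum.cong refl) (auto simp: b_def Y_def x indicator_def)
      also have "\<dots> = C + (\<Sum>r\<le>n. b r * indicator (Y r) x)"
        unfolding lessThan_Suc_atMost[symmetric] using True by (simp add: Y_def x)
      finally show ?thesis by (simp add: x)
    next
      case False
      have "fraction_multiple M W P Q \<le> b n * indicator (Y n) x"
        using False fraction_multiple_bounds by (simp add: b_def Y_def x)
      also have "\<dots> \<le> (\<Sum>r\<le>n. b r * indicator (Y r) x)"
        using b0 by (intro member_le_sum) auto
      finally show ?thesis using C0 by (simp add: x)
    qed
  qed (auto intro: fraction_multiple_bounds)
  also have "(\<Sum>r\<in>{..n}. b r * measure_pmf.prob p (Y r)) =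
      b n * measure_pmf.prob p (Y n) + (\<Sum>r<n. b r * measure_pmf.prob p (Y r))"
    unfolding lessThan_Suc_atMost[symmetric] by simp
  also have "b n * measure_pmf.prob p (Y n) \<le> real W * real M ^ 2 * (A * exp (- c * real L))"
    unfolding p_def random_instance_def
    using prob_not_nearly_sorted_le[OF ratio A c L]
    by (auto simp: b_def Y_def intro!: prob_pair_pmf_le')
  also have "(\<Sum>r<n. b r * measure_pmf.prob p (Y r)) \<le>
      (\<Sum>r<n. real g / N' * (real (g + L) ^ 2 * real k / real R))"
  proof (rule sum_mono)
    fix r assume r: "r \<in> {..<n}"
    then have "Suc r * g \<le> n * g" by (intro mult_right_mono) auto
    then have M: "r * g + (g + L) \<le> M" and W: "R \<le> W - r * g" "r * g < W"
      using N R by auto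
    have "measure_pmf.prob p (Y r) \<le> real (g + L) ^ 2 * (real k / real (W - r * g))"
      unfolding p_def random_instance_def
    proof (rule prob_pair_pmf_le)
      fix Q assume "Q \<in> set_pmf (Pi_pmf {1..W} [] D)"
      then have "complete_lists W M Q" using complete_lists_permutations supp by blast
      from prob_not_separated_le[OF this M W(2), of k]
      show "measure_pmf.prob (uniform_lists M W) {P. (P, Q) \<in> Y r}
          \<le> real (g + L) ^ 2 * (real k / real (W - r * g))"
        using r by (simp add: Y_def window_def add.assoc)
    qed
    also have "\<dots> \<le> real (g + L) ^ 2 * (real k / real R)"
      by (intro mult_left_mono frac_le of_nat_mono) (use W R in simp_all)
    finally have "real g / N' * measure_pmf.prob p (Y r) \<le> real g / N' * (real (g + L) ^ 2 * (real k / real R))"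
      using N'pos by (intro mult_left_mono) auto
    then show "b r * measure_pmf.prob p (Y r) \<le> real g / N' * (real (g + L) ^ 2 * real k / real R)"
      using r by (simp add: b_def)
  qed
  also have "(\<Sum>r<n. real g / N' * (real (g + L) ^ 2 * real k / real R)) =
      real n * real g / N' * (real (g + L) ^ 2 * real k / real R)" by simp
  finally show ?thesis
    unfolding expected_fraction_def p_def C_def N'_def k_def by (simp only: add.assoc)
qed

section \<open>Choice of the scales and the limit\<close>

text \<open>With \<open>q\<close> about the eighth root of \<open>min M W\<close>, take
  \<open>L = q\<close>, windows of \<open>q ^ 2\<close> men and a reserve of about a
  \<open>q\<close>-th part of the minimum, hence at least \<open>q ^ 7\<close>. Then the number of
  pairs in a window times the list depth is of order \<open>q ^ 6\<close>, a factor \<open>q\<close>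
  below the reserve.\<close>

lemma expected_fraction_le_scale:
  fixes q :: nat
  assumes supp: "\<forall>w\<in>{1..W}. set_pmf (D w) \<subseteq> permutations_of_set {1..M}"
    and ratio: "\<And>k. k \<ge> 1 \<Longrightarrow> max_pref_ratio M W D k \<le> ennreal (A * exp (- c * real k))"
    and A: "A > 0" and c: "c > 0" and q: "q \<ge> 4"
    and N: "q ^ 8 \<le> min M W" "min M W \<le> (q + 1) ^ 8"
  shows "expected_fraction M W D \<le> 14 / real q + A * real (q + 1) ^ 48 * exp (- c * real q)"
proof -
  define N' where "N' = min M W"
  have "0 < q ^ 8" using q by simp
  then have N'0: "0 < N'" using N unfolding N'_def by linarith
  have qN: "real q ^ 8 \<le> real N'" using N(1) unfolding N'_def by (simp only: of_nat_power[symmetric] of_nat_le_iff)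
  have e0: "0 \<le> A * real (q + 1) ^ 48 * exp (- c * real q)" using A by simp
  have q0: "real q \<ge> 4" using q by simp
  have qq: "4 * real q \<le> real q ^ 2"
    using q0 by (simp add: power2_eq_square)
  show ?thesis
  \<comment> \<open>Unbalanced sizes are covered by the trivial bound. Otherwise both sizes are at
    most \<open>N' ^ 2\<close>, so the union bound over women and pairs of men stays polynomial in
    \<open>q\<close>.\<close>
  proof (cases "N' ^ 2 \<le> M + W")
    case True
    have "expected_fraction M W D \<le> 2 * real N' / real (M + W)"
      using expected_fraction_le_sizes[OF supp] by (simp add: N'_def)
    also have "\<dots> \<le> 2 * real N' / real (N' ^ 2)"
      using True N'0 by (intro frac_le of_nat_mono) simp_all
    also have "\<dots> = 2 / real N'" using N'0 by (simp add: power2_eq_square)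
    also have "\<dots> \<le> 2 / real q ^ 8" using qN q0 by (intro frac_le) auto
    also have "\<dots> \<le> 14 / real q" using q0 power_increasing[of 1 8 "real q"] by (intro frac_le) auto
    finally show ?thesis using e0 by linarith
  next
    case False
    then have MW: "M \<le> N' ^ 2" "W \<le> N' ^ 2" by auto
    define g where "g = q ^ 2"
    define R where "R = N' div q"
    define n where "n = (N' - R) div g"
    have g0: "g > 0" using q by (simp add: g_def)
    have RN: "R \<le> N'" by (simp add: R_def)
    have "q ^ 7 * q \<le> N'" using N(1) by (simp add: N'_def power_Suc2[symmetric] del: power_Suc)
    then have Rq: "q ^ 7 \<le> R" unfolding R_def using q by (subst less_eq_div_iff_mult_less_eq) auto
    have "n * g \<le> N' - R" unfolding n_def by (rule div_times_less_eq_dividend)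
    then have ngR: "n * g + R \<le> min M W" using RN unfolding N'_def by linarith
    have "N' - R < n * g + g"
      unfolding n_def using g0 by (metis add.commute dividend_less_times_div mult.commute)
    then have ng: "N' \<le> n * g + g + R" by linarith
    have gL: "4 * q \<le> g" using q by (simp add: g_def power2_eq_square)
    have "4 * q \<le> q ^ 2" using q by (simp add: power2_eq_square)
    then have "3 * q + 1 \<le> q ^ 2" using q by linarith
    then have R: "g + 3 * q + 1 \<le> 2 * q ^ 2" by (simp add: g_def)
    have "2 * q ^ 2 \<le> q * q ^ 2" using q by (intro mult_right_mono) auto
    also have "\<dots> \<le> q ^ 7" using q by (simp only: power_Suc[symmetric]) (intro power_increasing; simp)
    finally have R': "g + 3 * q + 1 \<le> R" using R Rq by linarith
    have rq: "real q ^ 7 \<le> real R" using Rq by (simp only: of_nat_power[symmetric] of_nat_le_iff)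
    have "expected_fraction M W D \<le>
        (real N' - real n * (real g - 4 * real q)) / real N' +
        real W * real M ^ 2 * (A * exp (- c * real q)) +
        real n * real g / real N' * (real (g + q) ^ 2 * real (g + 3 * q + 1) / real R)"
      unfolding N'_def
      by (rule expected_fraction_le[OF supp ratio A c _ ngR R' gL]) (use q in auto)
    \<comment> \<open>Rounding to whole windows loses at most \<open>g\<close>, the reserve
      \<open>R\<close>, and the exceptions \<open>4 * q\<close> per window. In units of
      \<open>N' / q\<close> these cost at most 1, 1 and 4.\<close>
    also have "(real N' - real n * (real g - 4 * real q)) / real N' \<le> 6 / real q"
    proof -
      have 1: "real g \<le> real N' / real q"
      proof -
        have "real g * real q = real q ^ 3" by (simp add: g_def power3_eq_cube power2_eq_square)
        also have "\<dots> \<le> real q ^ 8" using q0 by (intro power_increasing) auto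
        also note qN
        finally show ?thesis using q0 by (simp add: le_divide_eq)
      qed
      have 2: "real R \<le> real N' / real q" unfolding R_def by (rule of_nat_div_le_of_nat)
      have 3: "real n * real q \<le> real N' / real q"
      proof -
        have "real n * real q * real q = real (n * g)" by (simp add: g_def power2_eq_square)
        also have "\<dots> \<le> real N'" using ngR unfolding N'_def by (intro of_nat_mono) linarith
        finally show ?thesis using q0 by (simp add: le_divide_eq)
      qed
      have "real N' \<le> real n * real g + real g + real R"
        using ng by (metis of_nat_add of_nat_le_iff of_nat_mult)
      then have "real N' - real n * (real g - 4 * real q) \<le> 6 * (real N' / real q)"
        using 1 2 3 by (simp add: algebra_simps)
      then show ?thesis using N'0 q0 by (simp add: divide_simps)
    qed
    also have "real W * real M ^ 2 * (A * exp (- c * real q)) \<le> A * real (q + 1) ^ 48 * exp (- c * real q)"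
    proof -
      have "real W * real M ^ 2 \<le> real (N' ^ 2) * real (N' ^ 2) ^ 2"
        using MW by (intro mult_mono power_mono of_nat_mono) auto
      also have "\<dots> = real N' ^ 6" by (simp flip: power_mult power_add)
      also have "\<dots> \<le> (real (q + 1) ^ 8) ^ 6"
        using N(2) unfolding N'_def by (intro power_mono) (simp_all only: of_nat_power[symmetric] of_nat_le_iff of_nat_0_le_iff)
      also have "\<dots> = real (q + 1) ^ 48" by (simp flip: power_mult)
      finally have "real W * real M ^ 2 * (A * exp (- c * real q)) \<le> real (q + 1) ^ 48 * (A * exp (- c * real q))"
        using A by (intro mult_right_mono) auto
      then show ?thesis by (simp only: mult_ac)
    qed
    also have "real n * real g / real N' * (real (g + q) ^ 2 * real (g + 3 * q + 1) / real R) \<le> 8 / real q"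
    proof -
      have "real n * real g \<le> real N'"
        unfolding of_nat_mult[symmetric] of_nat_le_iff using ngR N'_def by linarith
      then have 1: "real n * real g / real N' \<le> 1" using N'0 by simp
      have gq: "real (g + q) \<le> 2 * real q ^ 2"
        unfolding g_def of_nat_add of_nat_power using qq q0 by linarith
      have gk: "real (g + 3 * q + 1) \<le> 2 * real q ^ 2"
        using of_nat_mono[OF R, where ?'a = real] by simp
      have "real (g + q) ^ 2 * real (g + 3 * q + 1) / real R \<le> (2 * real q ^ 2) ^ 2 * (2 * real q ^ 2) / real q ^ 7"
        using gq gk rq q0 by (intro frac_le mult_mono power_mono) auto
      also have "\<dots> = 8 * (real q ^ 6 / real q ^ 7)"
        by (simp add: power_mult_distrib flip: power_mult power_add)
      also have "\<dots> = 8 / real q"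
        using q0 by (simp add: divide_simps flip: power_Suc2)
      finally have "real n * real g / real N' * (real (g + q) ^ 2 * real (g + 3 * q + 1) / real R) \<le> 1 * (8 / real q)"
        using 1 by (intro mult_mono) auto
      then show ?thesis by simp
    qed
    finally have "expected_fraction M W D \<le> 6 / real q + A * real (q + 1) ^ 48 * exp (- c * real q) + 8 / real q"
      by simp
    also have "6 / real q + 8 / real q \<le> 14 / real q"
      unfolding add_divide_distrib[symmetric] by (intro divide_right_mono) auto
    then have "6 / real q + A * real (q + 1) ^ 48 * exp (- c * real q) + 8 / real q
        \<le> 14 / real q + A * real (q + 1) ^ 48 * exp (- c * real q)" by linarith
    finally show ?thesis .
  qed
qed

lemma ex_floor_root:
  fixes N k :: nat
  assumes "k > 0"
  shows "\<exists>q. q ^ k \<le> N \<and> N < (q + 1) ^ k"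
proof (induction N)
  case 0
  show ?case using assms by (intro exI[of _ 0]) auto
next
  case (Suc N)
  then obtain q where q: "q ^ k \<le> N" "N < (q + 1) ^ k" by blast
  show ?case
  proof (cases "Suc N < (q + 1) ^ k")
    case True
    with q show ?thesis by (intro exI[of _ q]) auto
  next
    case False
    moreover have "(q + 1) ^ k < (q + 2) ^ k" using assms by (intro power_strict_mono) auto
    ultimately show ?thesis using q by (intro exI[of _ "q + 1"]) auto
  qed
qed

theorem theorem2:
  fixes A c :: real
  assumes "A > 0" and "c > 0"
  shows "((\<lambda>(M, W, D). expected_fraction M W D) \<longlongrightarrow> 0)
    (inf (filtercomap (\<lambda>(M, W, D). min M W) at_top)
         (principal {(M :: nat, W :: nat, D :: nat \<Rightarrow> nat list pmf).
            (\<forall>w\<in>{1..W}. set_pmf (D w) \<subseteq> permutations_of_set {1..M} \<and> regular {1..M} (D w)) \<and>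
            (\<forall>k\<ge>1. max_pref_ratio M W D k \<le> ennreal (A * exp (- c * real k)))}))"
proof (rule tendstoI)
  fix e :: real assume "e > 0"
  have "(\<lambda>q. 14 / real q + A * real (q + 1) ^ 48 * exp (- c * real q)) \<longlonglongrightarrow> 0"
    using assms by real_asymp
  then have "eventually (\<lambda>q. 14 / real q + A * real (q + 1) ^ 48 * exp (- c * real q) < e) sequentially"
    using \<open>e > 0\<close> by (rule order_tendstoD(2))
  then obtain q0 where q0: "\<And>q. q \<ge> q0 \<Longrightarrow> 14 / real q + A * real (q + 1) ^ 48 * exp (- c * real q) < e"
    by (auto simp: eventually_sequentially)
  \<comment> \<open>The threshold \<open>q0\<close> depends only on \<open>A\<close>,
    \<open>c\<close> and \<open>e\<close>, so the estimate is uniform in the sizes and in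
    \<open>D\<close>.\<close>
  have main: "dist (expected_fraction M W D) 0 < e"
    if N: "(max 4 q0) ^ 8 \<le> min M W"
      and supp: "\<forall>w\<in>{1..W}. set_pmf (D w) \<subseteq> permutations_of_set {1..M}"
      and ratio: "\<And>k. k \<ge> 1 \<Longrightarrow> max_pref_ratio M W D k \<le> ennreal (A * exp (- c * real k))"
    for M W :: nat and D
  proof -
    obtain q where q: "q ^ 8 \<le> min M W" "min M W < (q + 1) ^ 8"
      using ex_floor_root[of 8 "min M W"] by auto
    have "(max 4 q0) ^ 8 < (q + 1) ^ 8" using N q(2) by linarith
    then have "max 4 q0 < q + 1" by (rule power_less_imp_less_base) simp
    then have "q \<ge> 4" "q \<ge> q0" by auto
    then have "expected_fraction M W D < e"
      using expected_fraction_le_scale[OF supp ratio assms _ q(1)] q(2) q0[of q] by fastforce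
    then show ?thesis using expected_fraction_nonneg[of M W D] by simp
  qed
  have "eventually (\<lambda>x. (max 4 q0) ^ 8 \<le> min (fst x) (fst (snd x)))
      (filtercomap (\<lambda>(M, W, D :: nat \<Rightarrow> nat list pmf). min M W) at_top)"
    using eventually_filtercomapI[OF eventually_ge_at_top[of "(max 4 q0) ^ 8"],
        of "\<lambda>(M, W, D :: nat \<Rightarrow> nat list pmf). min M W"]
    by (simp add: case_prod_beta)
  then have "eventually (\<lambda>(M, W, D).
      (\<forall>w\<in>{1..W}. set_pmf (D w) \<subseteq> permutations_of_set {1..M} \<and> regular {1..M} (D w)) \<and>
      (\<forall>k\<ge>1. max_pref_ratio M W D k \<le> ennreal (A * exp (- c * real k))) \<longrightarrow>
      dist (expected_fraction M W D) 0 < e) (filtercomap (\<lambda>(M, W, D). min M W) at_top)"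
    by (rule eventually_mono) (clarify, rule main, simp_all only: fst_conv snd_conv, blast)
  then show "eventually (\<lambda>x. dist ((\<lambda>(M, W, D). expected_fraction M W D) x) 0 < e)
    (inf (filtercomap (\<lambda>(M, W, D). min M W) at_top)
         (principal {(M :: nat, W :: nat, D :: nat \<Rightarrow> nat list pmf).
            (\<forall>w\<in>{1..W}. set_pmf (D w) \<subseteq> permutations_of_set {1..M} \<and> regular {1..M} (D w)) \<and>
            (\<forall>k\<ge>1. max_pref_ratio M W D k \<le> ennreal (A * exp (- c * real k)))}))"
    \<comment> \<open>The principal filter turns the conditions on the instance into premises of an
      implication that has to hold once the minimum is large.\<close>
    unfolding eventually_inf_principal by (rule eventually_mono) auto
qed

end
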